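(* Let $\mathbb{D}=\{z\in\mathbb{C}:|z|<1\}$, and let $\{a_n\}_{n\ge 0}$ and $\{b_n\}_{n\ge 0}$ be sequences of complex numbers with $a_n\neq 0$ for all $n\ge 0$. Assume that $$\inf_{n\ge 0}\Big|\frac{a_n}{a_{n+1}}\Big|>0,\qquad \sup_{n\ge 0}\Big|\frac{a_n}{a_{n+1}}\Big|<\infty,\qquad \limsup_{n\to\infty}\Big|\frac{b_n}{a_{n+1}}\Big|<1.$$ Put $f_n(z)=(a_n+b_nz)z^n$ for $n\ge 0$, and assume that the series $$k(z,w)=\sum_{n=0}^\infty f_n(z)\overline{f_n(w)}$$ converges for all $z,w\in\mathbb{D}$. Let $\mathcal{H}_k$ be the Hilbert space of analytic functions on $\mathbb{D}$ with reproducing kernel $k$, in which $\{f_n\}_{n\ge 0}$ is an orthonormal basis, and let $M_z$ be the operator on $\mathcal{H}_k$ given by $(M_zf)(z)=zf(z)$. Then there exist a compact operator $K$ and an isometry $S$ on $\mathcal{H}_k$ with $M_z=K+S$ if and only if $$\lim_{n\to\infty}\Big|\frac{a_n}{a_{n+1}}\Big|=1\quad\text{and}\quad \lim_{n\to\infty}\Big|\frac{b_n}{a_n}-\frac{b_{n+1}}{a_{n+1}}\Big|=0.$$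
   Context: Hilbert spaces are over $\mathbb{C}$ and separable. Concretely, $\mathcal{H}_k$ consists of the functions $f=\sum_{n\ge 0}\alpha_nf_n$ (pointwise convergent on $\mathbb{D}$) with $\{\alpha_n\}\in\ell^2$, with norm $\|f\|^2=\sum_{n\ge 0}|\alpha_n|^2$; the coefficients $\alpha_n$ are uniquely determined by $f$. The kernel $k$ is called a tridiagonal kernel (band kernel with bandwidth one) and $M_z$ a tridiagonal shift. The assumptions $\sup_n|a_n/a_{n+1}|<\infty$ and $\limsup_n|b_n/a_{n+1}|<1$ ensure that $M_z$ is a well-defined bounded operator on $\mathcal{H}_k$, and the assumption that $\{|a_n/a_{n+1}|\}$ is bounded away from zero then ensures that $M_z$ is left-invertible (i.e. $LM_z=I$ for some bounded operator $L$ on $\mathcal{H}_k$). An isometry is a bounded linear operator $S$ on $\mathcal{H}_k$ with $S^*S=I$. *)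

theory Defs
  imports "HOL-Analysis.Analysis"
begin

definition tri_fun :: "(nat \<Rightarrow> complex) \<Rightarrow> (nat \<Rightarrow> complex) \<Rightarrow> nat \<Rightarrow> complex \<Rightarrow> complex" where
  "tri_fun a b n z = (a n + b n * z) * z ^ n"

(* A function on the open unit disc is represented by its extension by zero to all of
   the complex plane, so that equality of HOL functions is equality on the disc. *)
definition tri_expansion ::
    "(nat \<Rightarrow> complex) \<Rightarrow> (nat \<Rightarrow> complex) \<Rightarrow> (nat \<Rightarrow> complex) \<Rightarrow> (complex \<Rightarrow> complex) \<Rightarrow> bool" where
  "tri_expansion a b \<alpha> f \<longleftrightarrow>
     summable (\<lambda>n. (cmod (\<alpha> n))\<^sup>2) \<and>
     (\<forall>z\<in>ball 0 1. (\<lambda>n. \<alpha> n * tri_fun a b n z) sums f z) \<and>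
     (\<forall>z. z \<notin> ball 0 1 \<longrightarrow> f z = 0)"

definition tri_space :: "(nat \<Rightarrow> complex) \<Rightarrow> (nat \<Rightarrow> complex) \<Rightarrow> (complex \<Rightarrow> complex) set" where
  "tri_space a b = {f. \<exists>\<alpha>. tri_expansion a b \<alpha> f}"

(* The coefficients are unique when all a n are nonzero and the kernel series converges
   on the disc (compare power series coefficients recursively). *)
definition tri_coeff ::
    "(nat \<Rightarrow> complex) \<Rightarrow> (nat \<Rightarrow> complex) \<Rightarrow> (complex \<Rightarrow> complex) \<Rightarrow> nat \<Rightarrow> complex" where
  "tri_coeff a b f = (THE \<alpha>. tri_expansion a b \<alpha> f)"

definition tri_inner ::
    "(nat \<Rightarrow> complex) \<Rightarrow> (nat \<Rightarrow> complex) \<Rightarrow> (complex \<Rightarrow> complex) \<Rightarrow> (complex \<Rightarrow> complex) \<Rightarrow> complex" where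
  "tri_inner a b f g = (\<Sum>n. tri_coeff a b f n * cnj (tri_coeff a b g n))"

definition tri_norm ::
    "(nat \<Rightarrow> complex) \<Rightarrow> (nat \<Rightarrow> complex) \<Rightarrow> (complex \<Rightarrow> complex) \<Rightarrow> real" where
  "tri_norm a b f = sqrt (\<Sum>n. (cmod (tri_coeff a b f n))\<^sup>2)"

(* Operators are HOL functions of which only the restriction to the space matters. *)
definition bounded_operator ::
    "(nat \<Rightarrow> complex) \<Rightarrow> (nat \<Rightarrow> complex) \<Rightarrow> ((complex \<Rightarrow> complex) \<Rightarrow> complex \<Rightarrow> complex) \<Rightarrow> bool" where
  "bounded_operator a b T \<longleftrightarrow>
     (\<forall>f\<in>tri_space a b. T f \<in> tri_space a b) \<and>
     (\<forall>f\<in>tri_space a b. \<forall>g\<in>tri_space a b. T (\<lambda>z. f z + g z) = (\<lambda>z. T f z + T g z)) \<and>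
     (\<forall>c. \<forall>f\<in>tri_space a b. T (\<lambda>z. c * f z) = (\<lambda>z. c * T f z)) \<and>
     (\<exists>C. \<forall>f\<in>tri_space a b. tri_norm a b (T f) \<le> C * tri_norm a b f)"

definition compact_operator ::
    "(nat \<Rightarrow> complex) \<Rightarrow> (nat \<Rightarrow> complex) \<Rightarrow> ((complex \<Rightarrow> complex) \<Rightarrow> complex \<Rightarrow> complex) \<Rightarrow> bool" where
  "compact_operator a b T \<longleftrightarrow>
     bounded_operator a b T \<and>
     (\<forall>F :: nat \<Rightarrow> complex \<Rightarrow> complex.
        (\<forall>n. F n \<in> tri_space a b) \<and> (\<exists>C. \<forall>n. tri_norm a b (F n) \<le> C) \<longrightarrow>
        (\<exists>r :: nat \<Rightarrow> nat. strict_mono r \<and>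
           (\<exists>g\<in>tri_space a b.
              (\<lambda>n. tri_norm a b (\<lambda>z. T (F (r n)) z - g z)) \<longlonglongrightarrow> 0)))"

definition adjoint_operators ::
    "(nat \<Rightarrow> complex) \<Rightarrow> (nat \<Rightarrow> complex) \<Rightarrow> ((complex \<Rightarrow> complex) \<Rightarrow> complex \<Rightarrow> complex) \<Rightarrow>
     ((complex \<Rightarrow> complex) \<Rightarrow> complex \<Rightarrow> complex) \<Rightarrow> bool" where
  "adjoint_operators a b T T' \<longleftrightarrow>
     bounded_operator a b T \<and> bounded_operator a b T' \<and>
     (\<forall>f\<in>tri_space a b. \<forall>g\<in>tri_space a b. tri_inner a b (T f) g = tri_inner a b f (T' g))"

definition isometry_operator ::
    "(nat \<Rightarrow> complex) \<Rightarrow> (nat \<Rightarrow> complex) \<Rightarrow> ((complex \<Rightarrow> complex) \<Rightarrow> complex \<Rightarrow> complex) \<Rightarrow> bool" where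
  "isometry_operator a b S \<longleftrightarrow>
     (\<exists>S'. adjoint_operators a b S S' \<and> (\<forall>f\<in>tri_space a b. S' (S f) = f))"

definition mult_z :: "(complex \<Rightarrow> complex) \<Rightarrow> complex \<Rightarrow> complex" where
  "mult_z f = (\<lambda>z. z * f z)"

end

theory Submission
  imports Defs "HOL-Complex_Analysis.Great_Picard"
begin

text \<open>
  Put \<open>w\<^sub>n = a\<^sub>n / a\<^bsub>n+1\<^esub>\<close>, \<open>\<beta>\<^sub>n = b\<^sub>n / a\<^bsub>n+1\<^esub>\<close> and \<open>d\<^sub>n = b\<^sub>n / a\<^sub>n - b\<^bsub>n+1\<^esub> / a\<^bsub>n+1\<^esub>\<close>. In the basis
  \<open>f\<^sub>n\<close>, the operator \<open>M\<^sub>z\<close> is the weighted shift with weights \<open>w\<^sub>n\<close> plus the output of the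
  recurrence \<open>\<delta>\<^bsub>n+1\<^esub> = w\<^sub>n w\<^bsub>n+1\<^esub> d\<^sub>n \<alpha>\<^sub>n - \<beta>\<^bsub>n+1\<^esub> \<delta>\<^sub>n\<close>, which is bounded on square-summable input
  because \<open>limsup |\<beta>\<^sub>n| < 1\<close>. If \<open>|w\<^sub>n| \<longlonglongrightarrow> 1\<close> and \<open>d\<^sub>n \<longlonglongrightarrow> 0\<close>, then subtracting the isometric shift
  with weights \<open>w\<^sub>n / |w\<^sub>n|\<close> leaves an operator that is small on tails, hence compact.

  Conversely let \<open>M\<^sub>z = K + S\<close>. Then \<open>K\<close> annihilates weakly null sequences in the limit, so
  \<open>\<langle>z x\<^sub>n, z y\<^sub>n\<rangle> - \<langle>x\<^sub>n, y\<^sub>n\<rangle> \<longlonglongrightarrow> 0\<close> for bounded sequences supported on \<open>{n..}\<close>. Apply this to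
  \<open>y\<^sub>n = f\<^bsub>n+2\<^esub> / z\<close>, which is supported on \<open>{n+1..}\<close>: the choice \<open>x\<^sub>n = f\<^sub>n\<close> gives
  \<open>w\<^sub>n w\<^bsub>n+1\<^esub> d\<^sub>n \<longlonglongrightarrow> 0\<close>, and \<open>x\<^sub>n = f\<^bsub>n+1\<^esub>\<close> gives \<open>w\<^bsub>n+1\<^esub> - 1 / cnj w\<^bsub>n+1\<^esub> \<longlonglongrightarrow> 0\<close>.
\<close>

section \<open>Square-summable sequences\<close>

definition l2 :: "(nat \<Rightarrow> complex) set" where
  "l2 = {\<alpha>. summable (\<lambda>n. (cmod (\<alpha> n))\<^sup>2)}"

definition l2norm :: "(nat \<Rightarrow> complex) \<Rightarrow> real" where
  "l2norm \<alpha> = sqrt (\<Sum>n. (cmod (\<alpha> n))\<^sup>2)"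

definition l2inner :: "(nat \<Rightarrow> complex) \<Rightarrow> (nat \<Rightarrow> complex) \<Rightarrow> complex" where
  "l2inner \<alpha> \<gamma> = (\<Sum>n. \<alpha> n * cnj (\<gamma> n))"

abbreviation partial_norm :: "(nat \<Rightarrow> complex) \<Rightarrow> nat \<Rightarrow> real" where
  "partial_norm \<alpha> m \<equiv> L2_set (\<lambda>i. cmod (\<alpha> i)) {..<m}"

lemma l2norm_nonneg [simp]: "\<alpha> \<in> l2 \<Longrightarrow> 0 \<le> l2norm \<alpha>"
  by (simp add: l2_def l2norm_def suminf_nonneg)

lemma partial_norm_le_l2norm: "\<alpha> \<in> l2 \<Longrightarrow> partial_norm \<alpha> m \<le> l2norm \<alpha>"
  unfolding l2_def l2norm_def L2_set_def
  by (intro real_sqrt_le_mono sum_le_suminf) auto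

text \<open>Estimates are proved for finite sections and passed to the limit here. Membership in
  \<open>l2\<close> and the norm bound come out together, so no summability has to be known
  beforehand.\<close>

lemma l2_bounded_partial_norm:
  assumes "\<And>m. partial_norm \<alpha> m \<le> B"
  shows "\<alpha> \<in> l2" "l2norm \<alpha> \<le> B"
proof -
  have B: "0 \<le> B"
    using assms[of 0] by simp
  have le: "(\<Sum>n<m. (cmod (\<alpha> n))\<^sup>2) \<le> B\<^sup>2" for m
    using assms[of m] by (simp add: L2_set_def real_sqrt_le_iff sqrt_le_D)
  then show "\<alpha> \<in> l2"
    unfolding l2_def by (auto intro!: summableI_nonneg_bounded[where x="B\<^sup>2"])
  then show "l2norm \<alpha> \<le> B"
    unfolding l2_def l2norm_def using B le
    by (auto intro!: real_le_lsqrt suminf_le_const)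
qed

lemma l2_dominated:
  assumes "\<gamma> \<in> l2" "\<And>n. cmod (\<alpha> n) \<le> c * cmod (\<gamma> n)" "0 \<le> c"
  shows "\<alpha> \<in> l2" "l2norm \<alpha> \<le> c * l2norm \<gamma>"
proof -
  have "partial_norm \<alpha> m \<le> c * l2norm \<gamma>" for m
  proof -
    have "partial_norm \<alpha> m \<le> c * partial_norm \<gamma> m"
      using assms by (auto simp: L2_set_right_distrib intro!: L2_set_mono)
    also have "\<dots> \<le> c * l2norm \<gamma>"
      using assms by (intro mult_left_mono partial_norm_le_l2norm)
    finally show ?thesis .
  qed
  from l2_bounded_partial_norm[OF this] show "\<alpha> \<in> l2" "l2norm \<alpha> \<le> c * l2norm \<gamma>" .
qed

lemma partial_norm_add: "partial_norm (\<lambda>n. \<alpha> n + \<gamma> n) m \<le> partial_norm \<alpha> m + partial_norm \<gamma> m"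
proof -
  have "partial_norm (\<lambda>n. \<alpha> n + \<gamma> n) m \<le> L2_set (\<lambda>n. cmod (\<alpha> n) + cmod (\<gamma> n)) {..<m}"
    by (intro L2_set_mono) (auto simp: norm_triangle_ineq)
  also have "\<dots> \<le> partial_norm \<alpha> m + partial_norm \<gamma> m"
    by (rule L2_set_triangle_ineq)
  finally show ?thesis .
qed

lemma l2_add:
  assumes "\<alpha> \<in> l2" "\<gamma> \<in> l2"
  shows "(\<lambda>n. \<alpha> n + \<gamma> n) \<in> l2" "l2norm (\<lambda>n. \<alpha> n + \<gamma> n) \<le> l2norm \<alpha> + l2norm \<gamma>"
proof -
  have "partial_norm (\<lambda>n. \<alpha> n + \<gamma> n) m \<le> l2norm \<alpha> + l2norm \<gamma>" for m
    using partial_norm_add[of \<alpha> \<gamma> m] partial_norm_le_l2norm[OF assms(1), of m]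
      partial_norm_le_l2norm[OF assms(2), of m] by linarith
  from l2_bounded_partial_norm[OF this]
  show "(\<lambda>n. \<alpha> n + \<gamma> n) \<in> l2" "l2norm (\<lambda>n. \<alpha> n + \<gamma> n) \<le> l2norm \<alpha> + l2norm \<gamma>" .
qed

lemma l2_cmult: "\<alpha> \<in> l2 \<Longrightarrow> (\<lambda>n. c * \<alpha> n) \<in> l2"
  by (rule l2_dominated[where c="cmod c"]) (auto simp: norm_mult)

lemma l2_diff:
  assumes "\<alpha> \<in> l2" "\<gamma> \<in> l2"
  shows "(\<lambda>n. \<alpha> n - \<gamma> n) \<in> l2" "l2norm (\<lambda>n. \<alpha> n - \<gamma> n) \<le> l2norm \<alpha> + l2norm \<gamma>"
proof -
  have m: "(\<lambda>n. - \<gamma> n) \<in> l2" "l2norm (\<lambda>n. - \<gamma> n) = l2norm \<gamma>"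
    using assms(2) by (auto simp: l2_def l2norm_def)
  show "(\<lambda>n. \<alpha> n - \<gamma> n) \<in> l2" "l2norm (\<lambda>n. \<alpha> n - \<gamma> n) \<le> l2norm \<alpha> + l2norm \<gamma>"
    using l2_add[OF assms(1) m(1)] m(2) by auto
qed

text \<open>The first entry is split off rather than the last, because the recurrences below are
  treated by shifting the index.\<close>

lemma partial_norm_Suc_eq:
  "partial_norm \<alpha> (Suc m) = sqrt ((cmod (\<alpha> 0))\<^sup>2 + (partial_norm (\<lambda>n. \<alpha> (Suc n)) m)\<^sup>2)"
  by (simp add: L2_set_def sum.lessThan_Suc_shift sum_nonneg del: sum.lessThan_Suc)

lemma partial_norm_Suc:
  shows "partial_norm \<alpha> (Suc m) \<le> cmod (\<alpha> 0) + partial_norm (\<lambda>n. \<alpha> (Suc n)) m"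
    and "partial_norm (\<lambda>n. \<alpha> (Suc n)) m \<le> partial_norm \<alpha> (Suc m)"
    and "cmod (\<alpha> 0) \<le> partial_norm \<alpha> (Suc m)"
  unfolding partial_norm_Suc_eq
  by (auto intro: sqrt_sum_squares_le_sum)

lemma partial_norm_mono: "m \<le> m' \<Longrightarrow> partial_norm \<alpha> m \<le> partial_norm \<alpha> m'"
  unfolding L2_set_def by (intro real_sqrt_le_mono sum_mono2) auto

text \<open>\<open>case_nat 0 \<alpha>\<close> is the unilateral shift of \<open>\<alpha>\<close>:
  the prepended zero adds nothing to the sum of squares.\<close>

lemma l2_case_nat:
  assumes "\<alpha> \<in> l2"
  shows "case_nat 0 \<alpha> \<in> l2" "l2norm (case_nat 0 \<alpha>) = l2norm \<alpha>"
proof -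
  have s: "summable (\<lambda>n. (cmod (case_nat 0 \<alpha> (Suc n)))\<^sup>2)"
    using assms by (simp add: l2_def)
  then have s': "summable (\<lambda>n. (cmod (case_nat 0 \<alpha> n))\<^sup>2)"
    by (subst (asm) summable_Suc_iff)
  then show "case_nat 0 \<alpha> \<in> l2" by (simp add: l2_def)
  show "l2norm (case_nat 0 \<alpha>) = l2norm \<alpha>"
    using suminf_split_head[OF s'] by (simp add: l2norm_def)
qed

lemma l2_Suc:
  assumes "\<alpha> \<in> l2"
  shows "(\<lambda>n. \<alpha> (Suc n)) \<in> l2" "l2norm (\<lambda>n. \<alpha> (Suc n)) \<le> l2norm \<alpha>"
proof -
  have "partial_norm (\<lambda>n. \<alpha> (Suc n)) m \<le> l2norm \<alpha>" for m
    using partial_norm_Suc(2)[of \<alpha> m] partial_norm_le_l2norm[OF assms, of "Suc m"] by linarith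
  from l2_bounded_partial_norm[OF this]
  show "(\<lambda>n. \<alpha> (Suc n)) \<in> l2" "l2norm (\<lambda>n. \<alpha> (Suc n)) \<le> l2norm \<alpha>" .
qed

lemma l2_finite_support:
  assumes "\<And>n. n \<ge> N \<Longrightarrow> \<alpha> n = 0"
  shows "\<alpha> \<in> l2" "l2norm \<alpha> = partial_norm \<alpha> N"
proof -
  have "(\<lambda>n. (cmod (\<alpha> n))\<^sup>2) sums (\<Sum>n<N. (cmod (\<alpha> n))\<^sup>2)"
    using assms by (intro sums_finite) auto
  then show "\<alpha> \<in> l2" "l2norm \<alpha> = partial_norm \<alpha> N"
    by (auto simp: l2_def l2norm_def L2_set_def sums_iff)
qed

lemma cmod_le_l2norm: "\<alpha> \<in> l2 \<Longrightarrow> cmod (\<alpha> n) \<le> l2norm \<alpha>"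
  using partial_norm_le_l2norm[of \<alpha> "Suc n"]
    member_le_L2_set[of "{..<Suc n}" n "\<lambda>i. cmod (\<alpha> i)"] by simp

section \<open>Cauchy-Schwarz, the inner product and weakly null sequences\<close>

lemma l2inner_summable:
  assumes "\<alpha> \<in> l2" "\<gamma> \<in> l2"
  shows "summable (\<lambda>n. cmod (\<alpha> n * cnj (\<gamma> n)))"
    and "summable (\<lambda>n. \<alpha> n * cnj (\<gamma> n))"
    and "cmod (l2inner \<alpha> \<gamma>) \<le> l2norm \<alpha> * l2norm \<gamma>"
proof -
  \<comment> \<open>The finite Cauchy-Schwarz bound is uniform in \<open>m\<close>; it therefore
    yields absolute convergence first and then the bound on the whole series.\<close>
  have le: "(\<Sum>n<m. cmod (\<alpha> n * cnj (\<gamma> n))) \<le> l2norm \<alpha> * l2norm \<gamma>" for m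
  proof -
    have "(\<Sum>n<m. cmod (\<alpha> n * cnj (\<gamma> n))) \<le> partial_norm \<alpha> m * partial_norm \<gamma> m"
      using L2_set_mult_ineq[of "\<lambda>i. cmod (\<alpha> i)" "\<lambda>i. cmod (\<gamma> i)" "{..<m}"]
      by (simp add: norm_mult)
    also have "\<dots> \<le> l2norm \<alpha> * l2norm \<gamma>"
      by (intro mult_mono partial_norm_le_l2norm assms l2norm_nonneg) auto
    finally show ?thesis .
  qed
  show s: "summable (\<lambda>n. cmod (\<alpha> n * cnj (\<gamma> n)))"
    by (rule summableI_nonneg_bounded[where x="l2norm \<alpha> * l2norm \<gamma>"]) (use le in auto)
  then show "summable (\<lambda>n. \<alpha> n * cnj (\<gamma> n))"
    by (rule summable_norm_cancel)
  have "cmod (l2inner \<alpha> \<gamma>) \<le> (\<Sum>n. cmod (\<alpha> n * cnj (\<gamma> n)))"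
    unfolding l2inner_def by (rule summable_norm[OF s])
  also have "\<dots> \<le> l2norm \<alpha> * l2norm \<gamma>"
    by (rule suminf_le_const[OF s]) (use le in auto)
  finally show "cmod (l2inner \<alpha> \<gamma>) \<le> l2norm \<alpha> * l2norm \<gamma>" .
qed

lemma l2inner_add_left:
  "\<lbrakk>\<alpha> \<in> l2; \<alpha>' \<in> l2; \<gamma> \<in> l2\<rbrakk> \<Longrightarrow>
    l2inner (\<lambda>n. \<alpha> n + \<alpha>' n) \<gamma> = l2inner \<alpha> \<gamma> + l2inner \<alpha>' \<gamma>"
  unfolding l2inner_def by (simp add: ring_distribs suminf_add l2inner_summable)

lemma l2inner_add_right:
  "\<lbrakk>\<alpha> \<in> l2; \<gamma> \<in> l2; \<gamma>' \<in> l2\<rbrakk> \<Longrightarrow>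
    l2inner \<alpha> (\<lambda>n. \<gamma> n + \<gamma>' n) = l2inner \<alpha> \<gamma> + l2inner \<alpha> \<gamma>'"
  unfolding l2inner_def by (simp add: ring_distribs suminf_add l2inner_summable)

lemma l2inner_self: "\<alpha> \<in> l2 \<Longrightarrow> l2inner \<alpha> \<alpha> = of_real ((l2norm \<alpha>)\<^sup>2)"
  unfolding l2inner_def l2norm_def l2_def
  by (simp add: complex_norm_square [symmetric] suminf_nonneg flip: of_real_power suminf_of_real)

text \<open>The pairing with \<open>X n\<close> sees only the tail of \<open>\<gamma>\<close> from
  index \<open>n\<close> on, so it is at most \<open>C\<close> times a tail norm that tends to 0.
  Bounded sequences whose support moves to infinity are thus weakly null.\<close>

lemma l2inner_tail_tendsto_0:
  assumes "\<And>n. X n \<in> l2" "\<And>n. l2norm (X n) \<le> C" "\<And>n j. j < n \<Longrightarrow> X n j = 0" "\<gamma> \<in> l2"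
  shows "(\<lambda>n. l2inner (X n) \<gamma>) \<longlonglongrightarrow> 0"
proof (rule Lim_null_comparison)
  define t where "t N n = (if n < N then 0 else \<gamma> n)" for N n
  have sm: "summable (\<lambda>n. (cmod (\<gamma> n))\<^sup>2)"
    using assms(4) by (simp add: l2_def)
  have t: "t N \<in> l2" for N
    by (rule l2_dominated[OF assms(4), of _ 1]) (auto simp: t_def)
  have tn: "l2norm (t N) = sqrt (\<Sum>n. (cmod (\<gamma> (n + N)))\<^sup>2)" for N
    using suminf_split_initial_segment[of "\<lambda>n. (cmod (t N n))\<^sup>2" N] t[of N]
    by (simp add: l2norm_def t_def l2_def)
  have "(\<lambda>N. \<Sum>n. (cmod (\<gamma> (n + N)))\<^sup>2) \<longlonglongrightarrow> 0"
  proof -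
    have "(\<lambda>N. (\<Sum>n. (cmod (\<gamma> n))\<^sup>2) - (\<Sum>n<N. (cmod (\<gamma> n))\<^sup>2)) \<longlonglongrightarrow>
        (\<Sum>n. (cmod (\<gamma> n))\<^sup>2) - (\<Sum>n. (cmod (\<gamma> n))\<^sup>2)"
      by (intro tendsto_intros summable_LIMSEQ sm)
    then show ?thesis by (simp add: suminf_minus_initial_segment[OF sm])
  qed
  from tendsto_real_sqrt[OF this] have "(\<lambda>N. l2norm (t N)) \<longlonglongrightarrow> 0"
    by (simp add: tn)
  from tendsto_mult_right_zero[OF this] show "(\<lambda>N. C * l2norm (t N)) \<longlonglongrightarrow> 0" .
  have "cmod (l2inner (X n) \<gamma>) \<le> C * l2norm (t n)" for n
  proof -
    have "l2inner (X n) \<gamma> = l2inner (X n) (t n)"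
      unfolding l2inner_def using assms(3)[of _ n]
      by (intro suminf_cong) (auto simp: t_def)
    then have "cmod (l2inner (X n) \<gamma>) \<le> l2norm (X n) * l2norm (t n)"
      using l2inner_summable(3)[OF assms(1) t] by simp
    also have "\<dots> \<le> C * l2norm (t n)"
      by (intro mult_right_mono assms l2norm_nonneg t)
    finally show ?thesis .
  qed
  then show "\<forall>\<^sub>F n in sequentially. norm (l2inner (X n) \<gamma>) \<le> C * l2norm (t n)"
    by simp
qed

section \<open>First-order linear recurrences\<close>

text \<open>Comparing Taylor coefficients leads to this recurrence twice: for multiplication by z
  and for the division of f_(n+2) by z.\<close>

fun recur :: "(nat \<Rightarrow> complex) \<Rightarrow> complex \<Rightarrow> (nat \<Rightarrow> complex) \<Rightarrow> nat \<Rightarrow> complex" where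
  "recur \<beta> x y 0 = x"
| "recur \<beta> x y (Suc n) = y n - \<beta> n * recur \<beta> x y n"

text \<open>Dropping the first term leaves a recurrence of the same kind with a new initial value.
  In \<open>recur_bound\<close> this removes the finitely many large \<open>\<beta> n\<close> one at
  a time.\<close>

lemma recur_Suc_shift:
  "recur \<beta> x y (Suc n) = recur (\<lambda>n. \<beta> (Suc n)) (y 0 - \<beta> 0 * x) (\<lambda>n. y (Suc n)) n"
  by (induction n) auto

lemma recur_add: "recur \<beta> 0 (\<lambda>n. y n + y' n) n = recur \<beta> 0 y n + recur \<beta> 0 y' n"
  by (induction n) (auto simp: algebra_simps)

lemma recur_cmult: "recur \<beta> 0 (\<lambda>n. c * y n) n = c * recur \<beta> 0 y n"
  by (induction n) (auto simp: algebra_simps)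

text \<open>After its first entry the solution R is \<open>y\<close> minus \<open>\<beta>\<close>
  times R, so passing from \<open>m\<close> to \<open>m + 1\<close> turns a constant c into 1 + q c.
  The constant \<open>1 / (1 - q)\<close> is the fixed point of this step.\<close>

lemma recur_bound_uniform:
  assumes "\<And>n. cmod (\<beta> n) \<le> q" "q < 1"
  shows "partial_norm (recur \<beta> x y) m \<le> 1 / (1 - q) * (cmod x + partial_norm y m)"
proof (induction m)
  case 0
  then show ?case using assms by simp
next
  case (Suc m)
  let ?R = "recur \<beta> x y"
  have q: "0 \<le> q" using assms(1)[of 0] norm_ge_zero order_trans by blast
  have "partial_norm (\<lambda>n. y n + - (\<beta> n * ?R n)) m
      \<le> partial_norm y m + partial_norm (\<lambda>n. - (\<beta> n * ?R n)) m"
    by (rule partial_norm_add)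
  also have "partial_norm (\<lambda>n. - (\<beta> n * ?R n)) m \<le> q * partial_norm ?R m"
    using assms q by (auto simp: L2_set_right_distrib norm_mult intro!: L2_set_mono mult_right_mono)
  also have "\<dots> \<le> q * (1 / (1 - q) * (cmod x + partial_norm y m))"
    using Suc q by (intro mult_left_mono)
  finally have "partial_norm (\<lambda>n. ?R (Suc n)) m
      \<le> partial_norm y m + q * (1 / (1 - q) * (cmod x + partial_norm y m))" by simp
  then have "partial_norm ?R (Suc m)
      \<le> cmod x + partial_norm y m + q * (1 / (1 - q) * (cmod x + partial_norm y m))"
    using partial_norm_Suc(1)[of ?R m] by simp
  also have "\<dots> = 1 / (1 - q) * (cmod x + partial_norm y m)"
    using assms(2) by (simp add: field_simps)
  also have "\<dots> \<le> 1 / (1 - q) * (cmod x + partial_norm y (Suc m))"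
    using assms(2) by (intro mult_left_mono add_left_mono partial_norm_mono) auto
  finally show ?case .
qed

text \<open>Induction on the number \<open>N\<close> of initial coefficients that may exceed
  \<open>q\<close>. The constant does not depend on \<open>x\<close>, \<open>y\<close> or
  \<open>m\<close>, which later gives bounds uniform over families of inputs.\<close>

lemma recur_bound:
  assumes "\<And>n. n \<ge> N \<Longrightarrow> cmod (\<beta> n) \<le> q" "q < 1"
  shows "\<exists>C\<ge>0. \<forall>x y m. partial_norm (recur \<beta> x y) m \<le> C * (cmod x + partial_norm y m)"
  using assms(1)
proof (induction N arbitrary: \<beta>)
  case 0
  then have "\<forall>x y m. partial_norm (recur \<beta> x y) m \<le> 1 / (1 - q) * (cmod x + partial_norm y m)"
    using recur_bound_uniform[OF _ assms(2)] by blast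
  moreover have "1 / (1 - q) \<ge> 0" using assms(2) by simp
  ultimately show ?case by blast
next
  case (Suc N)
  have "\<exists>C\<ge>0. \<forall>x y m. partial_norm (recur (\<lambda>n. \<beta> (Suc n)) x y) m \<le> C * (cmod x + partial_norm y m)"
    by (rule Suc.IH) (simp add: Suc.prems)
  then obtain C where C: "C \<ge> 0"
    "\<And>x y m. partial_norm (recur (\<lambda>n. \<beta> (Suc n)) x y) m \<le> C * (cmod x + partial_norm y m)"
    by blast
  \<comment> \<open>The summand 1 pays for the first entry \<open>x\<close>. The new initial value
    and the shifted input cost one copy each of the norm of \<open>y\<close>, whence the 2, and
    \<open>cmod (\<beta> 0)\<close> times \<open>cmod x\<close>.\<close>
  define C' where "C' = 1 + C * (2 + cmod (\<beta> 0))"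
  have C': "C' \<ge> 0" using C(1) by (simp add: C'_def)
  have "partial_norm (recur \<beta> x y) m \<le> C' * (cmod x + partial_norm y m)" for x y m
  proof (cases m)
    case 0
    then show ?thesis using C' by simp
  next
    case (Suc k)
    let ?P = "partial_norm y (Suc k)"
    have "partial_norm (recur \<beta> x y) (Suc k) \<le> cmod x + C * (cmod (y 0 - \<beta> 0 * x) + partial_norm (\<lambda>n. y (Suc n)) k)"
      using partial_norm_Suc(1)[of "recur \<beta> x y" k] C(2)[of "y 0 - \<beta> 0 * x" "\<lambda>n. y (Suc n)" k]
      unfolding recur_Suc_shift by simp
    also have "\<dots> \<le> cmod x + C * ((?P + cmod (\<beta> 0) * cmod x) + ?P)"
      using partial_norm_Suc(2,3)[of y k] norm_triangle_ineq4[of "y 0" "\<beta> 0 * x"] C(1)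
      by (intro add_mono mult_left_mono) (auto simp: norm_mult)
    also have "\<dots> \<le> C' * (cmod x + ?P)"
      using C(1) by (simp add: C'_def algebra_simps)
    finally show ?thesis using Suc by simp
  qed
  with C' show ?case by blast
qed

section \<open>A compactness criterion\<close>

text \<open>Weak compactness of balls in coordinate form. A diagonal argument gives the
  coordinatewise limits; every finite section of \<open>g\<close> is a limit of sections bounded by
  \<open>B\<close>, so \<open>g\<close> inherits the bound.\<close>

lemma l2_pointwise_subseq:
  assumes "\<And>n. F n \<in> l2" "\<And>n. l2norm (F n) \<le> B"
  obtains r g where "strict_mono (r :: nat \<Rightarrow> nat)" "g \<in> l2" "l2norm g \<le> B"
    "\<And>j. (\<lambda>n. F (r n) j) \<longlonglongrightarrow> g j"
proof -
  have bd: "cmod (F n j) \<le> B" for n j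
    using cmod_le_l2norm[OF assms(1), of n j] assms(2)[of n] by linarith
  obtain r where r: "strict_mono (r :: nat \<Rightarrow> nat)"
    and lim: "\<And>j. j \<in> UNIV \<Longrightarrow> \<exists>l. (\<lambda>n. F (r n) j) \<longlonglongrightarrow> l"
    by (rule function_convergent_subsequence[of UNIV F B]) (simp_all add: bd)
  define g where "g j = lim (\<lambda>n. F (r n) j)" for j
  have g: "(\<lambda>n. F (r n) j) \<longlonglongrightarrow> g j" for j
    using lim[of j] by (simp add: g_def convergent_LIMSEQ_iff[symmetric] convergent_def)
  have "partial_norm g m \<le> B" for m
  proof (rule LIMSEQ_le_const2)
    show "(\<lambda>n. partial_norm (F (r n)) m) \<longlonglongrightarrow> partial_norm g m"
      unfolding L2_set_def by (intro tendsto_intros g)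
    show "\<exists>N. \<forall>n\<ge>N. partial_norm (F (r n)) m \<le> B"
      by (intro exI[of _ 0] allI impI order_trans[OF partial_norm_le_l2norm assms(2)] assms(1))
  qed
  from l2_bounded_partial_norm[OF this] show thesis
    by (intro that[of r g] r g)
qed

text \<open>Linearity is demanded on all sequences, boundedness only on \<open>l2\<close>: the
  operators below are given by coordinate formulas, and vectors can then be split without membership
  conditions.\<close>

definition bounded_linear_l2 :: "((nat \<Rightarrow> complex) \<Rightarrow> nat \<Rightarrow> complex) \<Rightarrow> bool" where
  "bounded_linear_l2 T \<longleftrightarrow>
     (\<forall>\<alpha> \<gamma>. T (\<lambda>n. \<alpha> n + \<gamma> n) = (\<lambda>n. T \<alpha> n + T \<gamma> n)) \<and>
     (\<forall>c \<alpha>. T (\<lambda>n. c * \<alpha> n) = (\<lambda>n. c * T \<alpha> n)) \<and>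
     (\<exists>C\<ge>0. \<forall>\<alpha>\<in>l2. T \<alpha> \<in> l2 \<and> l2norm (T \<alpha>) \<le> C * l2norm \<alpha>)"

lemma bounded_linear_l2D:
  assumes "bounded_linear_l2 T"
  shows "T (\<lambda>n. \<alpha> n + \<gamma> n) = (\<lambda>n. T \<alpha> n + T \<gamma> n)"
    and "T (\<lambda>n. c * \<alpha> n) = (\<lambda>n. c * T \<alpha> n)"
    and "\<alpha> \<in> l2 \<Longrightarrow> T \<alpha> \<in> l2"
  using assms by (auto simp: bounded_linear_l2_def)

lemma bounded_linear_l2_diff:
  assumes "bounded_linear_l2 T"
  shows "T (\<lambda>n. \<alpha> n - \<gamma> n) = (\<lambda>n. T \<alpha> n - T \<gamma> n)"
  using bounded_linear_l2D(1)[OF assms, of \<alpha> "\<lambda>n. - 1 * \<gamma> n"]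
    bounded_linear_l2D(2)[OF assms, of "- 1" \<gamma>] by simp

text \<open>Subtract the coordinatewise limit and split the difference at \<open>N\<close>. On the
  head, coordinatewise convergence is norm convergence; on the tail, \<open>small\<close> makes the
  image small.\<close>

lemma compact_criterion_l2:
  assumes T: "bounded_linear_l2 T"
    and small: "\<And>\<epsilon>. \<epsilon> > 0 \<Longrightarrow>
      \<exists>N. \<forall>\<alpha>\<in>l2. (\<forall>n<N. \<alpha> n = 0) \<longrightarrow> l2norm (T \<alpha>) \<le> \<epsilon> * l2norm \<alpha>"
    and F: "\<And>n. F n \<in> l2" "\<And>n. l2norm (F n) \<le> B"
  shows "\<exists>r. strict_mono (r :: nat \<Rightarrow> nat) \<and>
    (\<exists>g\<in>l2. (\<lambda>n. l2norm (\<lambda>j. T (F (r n)) j - g j)) \<longlonglongrightarrow> 0)"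
proof -
  obtain C where C: "C \<ge> 0" "\<And>\<alpha>. \<alpha> \<in> l2 \<Longrightarrow> T \<alpha> \<in> l2 \<and> l2norm (T \<alpha>) \<le> C * l2norm \<alpha>"
    using T unfolding bounded_linear_l2_def by auto
  obtain r g where r: "strict_mono (r :: nat \<Rightarrow> nat)" and g: "g \<in> l2" "l2norm g \<le> B"
    and lim: "\<And>j. (\<lambda>n. F (r n) j) \<longlonglongrightarrow> g j"
    using l2_pointwise_subseq[of F B, OF F] by blast
  define x where "x n j = F (r n) j - g j" for n j
  have x: "x n \<in> l2" "l2norm (x n) \<le> 2 * B" for n
    using l2_diff[OF F(1)[of "r n"] g(1)] F(2)[of "r n"] g(2) unfolding x_def by auto
  have x0: "(\<lambda>n. x n j) \<longlonglongrightarrow> 0" for j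
    using lim unfolding x_def by (simp add: LIM_zero)
  have B: "B \<ge> 0" using F(2)[of 0] l2norm_nonneg[OF F(1)[of 0]] by linarith
  have "(\<lambda>n. l2norm (T (x n))) \<longlonglongrightarrow> 0"
  proof (rule tendstoI)
    fix e :: real assume e: "e > 0"
    \<comment> \<open>The differences have norm at most \<open>2 * B\<close>, so the tail
      contributes at most \<open>e / 2\<close>. The extra 1 keeps the denominator positive when
      \<open>B\<close> is 0.\<close>
    define \<epsilon> where "\<epsilon> = e / (2 * (2 * B + 1))"
    have \<epsilon>: "\<epsilon> > 0" using e B by (simp add: \<epsilon>_def)
    obtain N where N: "\<And>\<alpha>. \<alpha> \<in> l2 \<Longrightarrow> (\<forall>n<N. \<alpha> n = 0) \<Longrightarrow> l2norm (T \<alpha>) \<le> \<epsilon> * l2norm \<alpha>"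
      using small[OF \<epsilon>] by blast
    have "(\<lambda>n. C * partial_norm (x n) N) \<longlonglongrightarrow> C * partial_norm (\<lambda>_. 0) N"
      unfolding L2_set_def by (intro tendsto_intros x0)
    then have "(\<lambda>n. C * partial_norm (x n) N) \<longlonglongrightarrow> 0" by (simp add: L2_set_def)
    then have ev: "\<forall>\<^sub>F n in sequentially. C * partial_norm (x n) N < e / 2"
      using e by (intro order_tendstoD(2)) auto
    have "l2norm (T (x n)) < e" if n: "C * partial_norm (x n) N < e / 2" for n
    proof -
      define u where "u j = (if j < N then x n j else 0)" for j
      define v where "v j = (if j < N then 0 else x n j)" for j
      have u: "u \<in> l2" "l2norm u = partial_norm u N"
        by (rule l2_finite_support[of N], simp add: u_def)+
      have pu: "partial_norm u N = partial_norm (x n) N"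
        by (rule L2_set_cong) (auto simp: u_def)
      have v: "v \<in> l2" "l2norm v \<le> 1 * l2norm (x n)"
        using l2_dominated[OF x(1)[of n], of v 1] by (auto simp: v_def)
      have "x n = (\<lambda>j. u j + v j)" by (auto simp: u_def v_def)
      then have "T (x n) = (\<lambda>j. T u j + T v j)"
        by (simp add: bounded_linear_l2D(1)[OF T])
      then have "l2norm (T (x n)) \<le> l2norm (T u) + l2norm (T v)"
        using l2_add(2)[of "T u" "T v"] C(2) u(1) v(1) by simp
      also have "l2norm (T u) \<le> C * partial_norm (x n) N"
        using C(2)[OF u(1)] u(2) pu by simp
      also have "l2norm (T v) \<le> \<epsilon> * l2norm v"
        using N[OF v(1)] by (simp add: v_def)
      also have "\<epsilon> * l2norm v \<le> \<epsilon> * (2 * B)"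
        using v(2) x(2)[of n] \<epsilon> by (intro mult_left_mono) auto
      also have "\<epsilon> * (2 * B) \<le> \<epsilon> * (2 * B + 1)"
        using \<epsilon> by (intro mult_left_mono) auto
      also have "\<dots> = e / 2"
        using B unfolding \<epsilon>_def by (simp add: field_simps)
      finally show ?thesis using n by simp
    qed
    then have "\<forall>\<^sub>F n in sequentially. l2norm (T (x n)) < e"
      by (rule eventually_mono[OF ev])
    then show "\<forall>\<^sub>F n in sequentially. dist (l2norm (T (x n))) 0 < e"
      by (simp add: C(2) x(1))
  qed
  moreover have "T (x n) = (\<lambda>j. T (F (r n)) j - T g j)" for n
    unfolding x_def by (rule bounded_linear_l2_diff[OF T])
  ultimately show ?thesis using r C(2)[OF g(1)] by (intro exI[of _ r]) auto
qed

section \<open>The space of a tridiagonal kernel\<close>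

locale tridiagonal =
  fixes a b :: "nat \<Rightarrow> complex"
  assumes a_nonzero: "\<And>n. a n \<noteq> 0"
    and kernel: "\<And>z w. z \<in> ball 0 1 \<Longrightarrow> w \<in> ball 0 1 \<Longrightarrow>
           summable (\<lambda>n. tri_fun a b n z * cnj (tri_fun a b n w))"
begin

section \<open>Taylor coefficients and uniqueness of the expansion\<close>

definition taylor :: "(nat \<Rightarrow> complex) \<Rightarrow> nat \<Rightarrow> complex" where
  "taylor \<alpha> n = a n * \<alpha> n + case_nat 0 (\<lambda>k. b k * \<alpha> k) n"

lemma taylor_simps [simp]:
  "taylor \<alpha> 0 = a 0 * \<alpha> 0"
  "taylor \<alpha> (Suc n) = a (Suc n) * \<alpha> (Suc n) + b n * \<alpha> n"
  by (auto simp: taylor_def)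

text \<open>The passage from basis coefficients to Taylor coefficients is lower bidiagonal with
  diagonal entries \<open>a n\<close>, which are nonzero, so it is inverted recursively.\<close>

lemma taylor_inject:
  assumes "taylor \<alpha> = taylor \<gamma>"
  shows "\<alpha> = \<gamma>"
proof
  fix n
  show "\<alpha> n = \<gamma> n"
  proof (induction n)
    case 0
    show ?case using fun_cong[OF assms, of 0] a_nonzero by simp
  next
    case (Suc n)
    then show ?case using fun_cong[OF assms, of "Suc n"] a_nonzero by simp
  qed
qed

text \<open>The value 0 off the disc follows the convention of \<open>tri_expansion\<close>, so that
  equality of the HOL functions is equality on the disc.\<close>

definition synthesis :: "(nat \<Rightarrow> complex) \<Rightarrow> complex \<Rightarrow> complex" where
  "synthesis \<alpha> z = (if z \<in> ball 0 1 then \<Sum>n. \<alpha> n * tri_fun a b n z else 0)"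

text \<open>On the diagonal the kernel series has the terms |f_n(z)|^2, which tend to 0 by
  convergence.\<close>

lemma tri_fun_tendsto_0:
  assumes "z \<in> ball 0 1"
  shows "(\<lambda>n. tri_fun a b n z) \<longlonglongrightarrow> 0"
proof -
  have "(\<lambda>n. tri_fun a b n z * cnj (tri_fun a b n z)) \<longlonglongrightarrow> 0"
    using kernel[OF assms assms] by (rule summable_LIMSEQ_zero)
  then have "(\<lambda>n. cmod (tri_fun a b n z * cnj (tri_fun a b n z))) \<longlonglongrightarrow> 0"
    by (rule tendsto_norm_zero)
  then have "(\<lambda>n. (cmod (tri_fun a b n z))\<^sup>2) \<longlonglongrightarrow> 0"
    by (simp add: norm_mult power2_eq_square)
  from tendsto_real_sqrt[OF this] show ?thesis
    by (simp add: tendsto_norm_zero_iff)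
qed

text \<open>Comparing \<open>f\<^sub>n(r)\<close> with \<open>f\<^sub>n(-r)\<close> separates the two coefficients, so both sequences
  generate power series that converge on the disc.\<close>

lemma a_b_bounded:
  assumes "0 < r" "r < 1"
  shows "\<exists>M. \<forall>n. cmod (a n) * r ^ n \<le> M" "\<exists>M. \<forall>n. cmod (b n) * r ^ n \<le> M"
proof -
  let ?z = "complex_of_real r"
  have t: "(\<lambda>n. tri_fun a b n ?z) \<longlonglongrightarrow> 0" "(\<lambda>n. tri_fun a b n (- ?z)) \<longlonglongrightarrow> 0"
    using assms by (auto intro!: tri_fun_tendsto_0)
  have t': "(\<lambda>n. cmod (tri_fun a b n ?z)) \<longlonglongrightarrow> 0" "(\<lambda>n. cmod (tri_fun a b n (- ?z))) \<longlonglongrightarrow> 0"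
    using t[THEN tendsto_norm_zero] by auto
  have s: "(\<lambda>n. cmod (tri_fun a b n ?z) + cmod (tri_fun a b n (- ?z))) \<longlonglongrightarrow> 0"
    using tendsto_add[OF t'] by simp
  from convergent_imp_Bseq[OF convergentI[OF s]] obtain M
    where M: "\<And>n. cmod (tri_fun a b n ?z) + cmod (tri_fun a b n (- ?z)) \<le> M"
    by (auto simp: Bseq_def)
  have e: "cmod (tri_fun a b n ?z) = cmod (a n + b n * r) * r ^ n"
    "cmod (tri_fun a b n (- ?z)) = cmod (a n - b n * r) * r ^ n" for n
    using assms by (auto simp: tri_fun_def norm_mult norm_power)
  have "cmod (a n) * r ^ n \<le> M" for n
  proof -
    have "2 * cmod (a n) = cmod ((a n + b n * r) + (a n - b n * r))"
      by (simp add: norm_mult flip: mult_2)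
    also have "\<dots> \<le> cmod (a n + b n * r) + cmod (a n - b n * r)"
      by (rule norm_triangle_ineq)
    finally have "2 * cmod (a n) * r ^ n \<le> (cmod (a n + b n * r) + cmod (a n - b n * r)) * r ^ n"
      using assms by (intro mult_right_mono) auto
    also have "\<dots> \<le> M" using M[of n] by (simp add: e algebra_simps)
    finally have "2 * (cmod (a n) * r ^ n) \<le> M" by (simp only: mult.assoc)
    moreover have "0 \<le> cmod (a n) * r ^ n" using assms by simp
    ultimately show ?thesis by linarith
  qed
  then show "\<exists>M. \<forall>n. cmod (a n) * r ^ n \<le> M" by blast
  have "cmod (b n) * r ^ n \<le> M / r" for n
  proof -
    have "2 * (cmod (b n) * r) = cmod ((a n + b n * r) - (a n - b n * r))"
      using assms by (simp add: norm_mult flip: mult_2)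
    also have "\<dots> \<le> cmod (a n + b n * r) + cmod (a n - b n * r)"
      by (rule norm_triangle_ineq4)
    finally have "2 * (cmod (b n) * r) * r ^ n \<le> (cmod (a n + b n * r) + cmod (a n - b n * r)) * r ^ n"
      using assms by (intro mult_right_mono) auto
    also have "\<dots> \<le> M" using M[of n] by (simp add: e algebra_simps)
    finally have "2 * (cmod (b n) * r ^ n * r) \<le> M" by (simp add: mult_ac)
    moreover have "0 \<le> cmod (b n) * r ^ n * r" using assms by simp
    ultimately have "cmod (b n) * r ^ n * r \<le> M" by linarith
    then show ?thesis using assms by (simp add: field_simps)
  qed
  then show "\<exists>M. \<forall>n. cmod (b n) * r ^ n \<le> M" by blast
qed

text \<open>Entries of \<open>\<alpha>\<close> are bounded by its norm, so
  \<open>c n * \<alpha> n\<close> grows at most like r^(-n). Abel's lemma at a radius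
  \<open>r\<close> strictly between \<open>cmod z\<close> and 1 gives absolute convergence.\<close>

lemma summable_mult_bounded:
  assumes "\<And>r. 0 < r \<Longrightarrow> r < 1 \<Longrightarrow> \<exists>M. \<forall>n. cmod (c n) * r ^ n \<le> M"
    and "\<alpha> \<in> l2" "cmod z < 1"
  shows "summable (\<lambda>n. c n * \<alpha> n * z ^ n)"
proof -
  obtain r where r: "cmod z < r" "r < 1"
    using dense[OF assms(3)] by blast
  then have r0: "0 < r" using norm_ge_zero[of z] by linarith
  obtain M where M: "\<And>n. cmod (c n) * r ^ n \<le> M"
    using assms(1)[OF r0 r(2)] by blast
  have "cmod (c n * \<alpha> n) * r ^ n \<le> M * l2norm \<alpha>" for n
  proof -
    have "cmod (c n * \<alpha> n) * r ^ n = (cmod (c n) * r ^ n) * cmod (\<alpha> n)"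
      by (simp add: norm_mult)
    also have "\<dots> \<le> M * l2norm \<alpha>"
      using M r0 assms(2) order_trans[OF _ M[of 0]]
      by (intro mult_mono cmod_le_l2norm) auto
    finally show ?thesis .
  qed
  from Abel_lemma[OF _ r(1) this]
  have "summable (\<lambda>n. cmod (c n * \<alpha> n) * cmod z ^ n)" by simp
  then have "summable (\<lambda>n. cmod (c n * \<alpha> n * z ^ n))"
    by (simp add: norm_mult norm_power)
  then show ?thesis by (rule summable_norm_cancel)
qed

text \<open>The \<open>a\<close> part and the \<open>b\<close> part converge separately. They may
  therefore be added term by term, or added after moving the \<open>b\<close> part up by one degree,
  which gives the Taylor series.\<close>

lemma synthesis_sums:
  assumes "\<alpha> \<in> l2" "z \<in> ball 0 1"
  shows "(\<lambda>n. \<alpha> n * tri_fun a b n z) sums synthesis \<alpha> z"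
    and "(\<lambda>n. taylor \<alpha> n * z ^ n) sums synthesis \<alpha> z"
proof -
  have z: "cmod z < 1" using assms(2) by simp
  have A: "summable (\<lambda>n. a n * \<alpha> n * z ^ n)"
    by (rule summable_mult_bounded[OF a_b_bounded(1) assms(1) z])
  have B: "summable (\<lambda>n. b n * \<alpha> n * z ^ n)"
    by (rule summable_mult_bounded[OF a_b_bounded(2) assms(1) z])
  let ?A = "\<Sum>n. a n * \<alpha> n * z ^ n" and ?B = "\<Sum>n. b n * \<alpha> n * z ^ n"
  have "(\<lambda>n. a n * \<alpha> n * z ^ n + z * (b n * \<alpha> n * z ^ n)) sums (?A + z * ?B)"
    by (intro sums_add sums_mult summable_sums A B)
  then have s: "(\<lambda>n. \<alpha> n * tri_fun a b n z) sums (?A + z * ?B)"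
    by (simp add: tri_fun_def algebra_simps)
  then have e: "synthesis \<alpha> z = ?A + z * ?B"
    using assms(2) by (simp add: synthesis_def sums_iff)
  show "(\<lambda>n. \<alpha> n * tri_fun a b n z) sums synthesis \<alpha> z"
    using s e by simp
  have "(\<lambda>n. case_nat 0 (\<lambda>k. b k * \<alpha> k) (Suc n) * z ^ Suc n) sums (z * ?B)"
    using sums_mult[OF summable_sums[OF B], of z] by (simp add: algebra_simps)
  then have "(\<lambda>n. case_nat 0 (\<lambda>k. b k * \<alpha> k) n * z ^ n) sums (z * ?B)"
    by (subst (asm) sums_Suc_iff) simp
  from sums_add[OF summable_sums[OF A] this]
  show "(\<lambda>n. taylor \<alpha> n * z ^ n) sums synthesis \<alpha> z"
    by (simp add: e taylor_def algebra_simps)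
qed

lemma powser_eq_0:
  fixes c :: "nat \<Rightarrow> complex"
  assumes "\<And>z. z \<in> ball 0 1 \<Longrightarrow> (\<lambda>n. c n * z ^ n) sums 0"
  shows "c n = 0"
proof (rule ccontr)
  assume "c n \<noteq> 0"
  \<comment> \<open>Isolation of zeros is applied below to a nonzero coefficient of positive index,
    so the constant term is settled first by evaluating at 0.\<close>
  have "c 0 = 0"
    using assms[of 0] by simp
  then have "n > 0" using \<open>c n \<noteq> 0\<close> by (cases n) auto
  show False
  proof (rule powser_0_nonzero[of 1 0 c "\<lambda>_. 0" n])
    fix s :: real
    assume "0 < s" and *: "\<And>z::complex. z \<in> cball 0 s - {0} \<Longrightarrow> (0 :: complex) \<noteq> 0"
    then show False using *[of "of_real s"] by simp
  qed (use assms \<open>c n \<noteq> 0\<close> \<open>n > 0\<close> in simp_all)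
qed

lemma synthesis_inject:
  assumes "\<alpha> \<in> l2" "\<gamma> \<in> l2" "synthesis \<alpha> = synthesis \<gamma>"
  shows "\<alpha> = \<gamma>"
proof (rule taylor_inject, rule ext)
  fix n
  have "taylor \<alpha> n - taylor \<gamma> n = 0"
  proof (rule powser_eq_0)
    fix z :: complex assume z: "z \<in> ball 0 1"
    from sums_diff[OF synthesis_sums(2)[OF assms(1) z] synthesis_sums(2)[OF assms(2) z]]
    show "(\<lambda>n. (taylor \<alpha> n - taylor \<gamma> n) * z ^ n) sums 0"
      by (simp add: assms(3) algebra_simps)
  qed
  then show "taylor \<alpha> n = taylor \<gamma> n" by simp
qed

text \<open>The bridge to sequences: with injectivity of \<open>synthesis\<close>, the space, its
  coefficients, norm and inner product all become those of \<open>l2\<close>.\<close>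

lemma tri_expansion_iff: "tri_expansion a b \<alpha> f \<longleftrightarrow> \<alpha> \<in> l2 \<and> f = synthesis \<alpha>"
proof
  assume *: "tri_expansion a b \<alpha> f"
  then have "f z = synthesis \<alpha> z" for z
    by (cases "z \<in> ball 0 1") (auto simp: tri_expansion_def synthesis_def sums_iff)
  with * show "\<alpha> \<in> l2 \<and> f = synthesis \<alpha>"
    by (auto simp: tri_expansion_def l2_def)
next
  assume "\<alpha> \<in> l2 \<and> f = synthesis \<alpha>"
  then show "tri_expansion a b \<alpha> f"
    using synthesis_sums(1) by (auto simp: tri_expansion_def l2_def synthesis_def)
qed

lemma tri_space_eq: "tri_space a b = synthesis ` l2"
  by (auto simp: tri_space_def tri_expansion_iff)

lemma tri_coeff_synthesis [simp]: "\<alpha> \<in> l2 \<Longrightarrow> tri_coeff a b (synthesis \<alpha>) = \<alpha>"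
  unfolding tri_coeff_def tri_expansion_iff
  by (rule the_equality) (auto dest: synthesis_inject)

lemma tri_coeff_in_l2: "f \<in> tri_space a b \<Longrightarrow> tri_coeff a b f \<in> l2"
  by (auto simp: tri_space_eq)

lemma synthesis_tri_coeff: "f \<in> tri_space a b \<Longrightarrow> synthesis (tri_coeff a b f) = f"
  by (auto simp: tri_space_eq)

lemma synthesis_in_space [simp]: "\<alpha> \<in> l2 \<Longrightarrow> synthesis \<alpha> \<in> tri_space a b"
  by (auto simp: tri_space_eq)

lemma tri_norm_eq: "tri_norm a b f = l2norm (tri_coeff a b f)"
  by (simp add: tri_norm_def l2norm_def)

lemma tri_inner_eq: "tri_inner a b f g = l2inner (tri_coeff a b f) (tri_coeff a b g)"
  by (simp add: tri_inner_def l2inner_def)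

lemma synthesis_eqI:
  assumes "\<gamma> \<in> l2" "\<And>z. z \<in> ball 0 1 \<Longrightarrow> (\<lambda>n. taylor \<gamma> n * z ^ n) sums f z"
    "\<And>z. z \<notin> ball 0 1 \<Longrightarrow> f z = 0"
  shows "synthesis \<gamma> = f"
proof
  fix z
  show "synthesis \<gamma> z = f z"
  proof (cases "z \<in> ball 0 1")
    case True
    from sums_unique2[OF synthesis_sums(2)[OF assms(1) True] assms(2)[OF True]]
    show ?thesis .
  next
    case False
    then show ?thesis using assms(3) by (simp add: synthesis_def)
  qed
qed

lemma synthesis_add:
  assumes "\<alpha> \<in> l2" "\<gamma> \<in> l2"
  shows "synthesis (\<lambda>n. \<alpha> n + \<gamma> n) = (\<lambda>z. synthesis \<alpha> z + synthesis \<gamma> z)"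
proof (rule synthesis_eqI)
  fix z :: complex assume z: "z \<in> ball 0 1"
  have "taylor (\<lambda>n. \<alpha> n + \<gamma> n) n = taylor \<alpha> n + taylor \<gamma> n" for n
    by (cases n) (auto simp: algebra_simps)
  then show "(\<lambda>n. taylor (\<lambda>n. \<alpha> n + \<gamma> n) n * z ^ n) sums (synthesis \<alpha> z + synthesis \<gamma> z)"
    using sums_add[OF synthesis_sums(2)[OF assms(1) z] synthesis_sums(2)[OF assms(2) z]]
    by (simp add: algebra_simps)
qed (use assms in \<open>auto simp: l2_add synthesis_def\<close>)

lemma synthesis_cmult:
  assumes "\<alpha> \<in> l2"
  shows "synthesis (\<lambda>n. c * \<alpha> n) = (\<lambda>z. c * synthesis \<alpha> z)"
proof (rule synthesis_eqI)
  fix z :: complex assume z: "z \<in> ball 0 1"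
  have "taylor (\<lambda>n. c * \<alpha> n) n = c * taylor \<alpha> n" for n
    by (cases n) (auto simp: algebra_simps)
  then show "(\<lambda>n. taylor (\<lambda>n. c * \<alpha> n) n * z ^ n) sums (c * synthesis \<alpha> z)"
    using sums_mult[OF synthesis_sums(2)[OF assms(1) z], of c]
    by (simp add: algebra_simps)
qed (use assms in \<open>auto simp: l2_cmult synthesis_def\<close>)

lemma synthesis_diff:
  assumes "\<alpha> \<in> l2" "\<gamma> \<in> l2"
  shows "synthesis (\<lambda>n. \<alpha> n - \<gamma> n) = (\<lambda>z. synthesis \<alpha> z - synthesis \<gamma> z)"
  using synthesis_add[OF assms(1) l2_cmult[OF assms(2), of "- 1"]]
    synthesis_cmult[OF assms(2), of "- 1"] by simp

lemma tri_coeff_add: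
  assumes "f \<in> tri_space a b" "g \<in> tri_space a b"
  shows "tri_coeff a b (\<lambda>z. f z + g z) = (\<lambda>n. tri_coeff a b f n + tri_coeff a b g n)"
proof -
  have "(\<lambda>z. f z + g z) = synthesis (\<lambda>n. tri_coeff a b f n + tri_coeff a b g n)"
    using assms by (simp add: synthesis_add tri_coeff_in_l2 synthesis_tri_coeff)
  then show ?thesis
    using assms by (simp add: l2_add tri_coeff_in_l2)
qed

lemma tri_coeff_diff:
  assumes "f \<in> tri_space a b" "g \<in> tri_space a b"
  shows "tri_coeff a b (\<lambda>z. f z - g z) = (\<lambda>n. tri_coeff a b f n - tri_coeff a b g n)"
proof -
  have "(\<lambda>z. f z - g z) = synthesis (\<lambda>n. tri_coeff a b f n - tri_coeff a b g n)"
    using assms by (simp add: synthesis_diff tri_coeff_in_l2 synthesis_tri_coeff)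
  then show ?thesis
    using assms by (simp add: l2_diff tri_coeff_in_l2)
qed

lemma tri_coeff_cmult:
  assumes "f \<in> tri_space a b"
  shows "tri_coeff a b (\<lambda>z. c * f z) = (\<lambda>n. c * tri_coeff a b f n)"
proof -
  have "(\<lambda>z. c * f z) = synthesis (\<lambda>n. c * tri_coeff a b f n)"
    using assms by (simp add: synthesis_cmult tri_coeff_in_l2 synthesis_tri_coeff)
  then show ?thesis
    using assms by (simp add: l2_cmult tri_coeff_in_l2)
qed

section \<open>Multiplication by z in terms of coefficients\<close>

lemma mult_z_synthesis:
  assumes "\<alpha> \<in> l2" "\<gamma> \<in> l2" "\<gamma> 0 = 0" "\<And>n. taylor \<gamma> (Suc n) = taylor \<alpha> n"
  shows "mult_z (synthesis \<alpha>) = synthesis \<gamma>"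
proof (rule synthesis_eqI[symmetric, OF assms(2)])
  fix z :: complex assume z: "z \<in> ball 0 1"
  \<comment> \<open>Multiplication by z moves every Taylor coefficient up by one degree; the vacated
    degree 0 is accounted for by \<open>\<gamma> 0 = 0\<close>.\<close>
  have "(\<lambda>n. taylor \<gamma> (Suc n) * z ^ Suc n) sums (z * synthesis \<alpha> z)"
    using sums_mult[OF synthesis_sums(2)[OF assms(1) z], of z] assms(4)
    by (simp add: algebra_simps del: taylor_simps)
  then show "(\<lambda>n. taylor \<gamma> n * z ^ n) sums mult_z (synthesis \<alpha>) z"
    by (subst (asm) sums_Suc_iff) (simp add: assms(3) mult_z_def)
qed (simp add: mult_z_def synthesis_def)

text \<open>Converse of \<open>mult_z_synthesis\<close>, by the identity theorem applied to the
  Taylor series of the two sides.\<close>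

lemma taylor_mult_z:
  assumes "\<alpha> \<in> l2" "\<gamma> \<in> l2" "mult_z (synthesis \<alpha>) = synthesis \<gamma>"
  shows "\<gamma> 0 = 0" "taylor \<gamma> (Suc n) = taylor \<alpha> n"
proof -
  have eq: "taylor \<gamma> n - case_nat 0 (taylor \<alpha>) n = 0" for n
  proof (rule powser_eq_0)
    fix z :: complex assume z: "z \<in> ball 0 1"
    have "(\<lambda>n. case_nat 0 (taylor \<alpha>) (Suc n) * z ^ Suc n) sums (z * synthesis \<alpha> z)"
      using sums_mult[OF synthesis_sums(2)[OF assms(1) z], of z] by (simp add: algebra_simps)
    then have "(\<lambda>n. case_nat 0 (taylor \<alpha>) n * z ^ n) sums (z * synthesis \<alpha> z)"
      by (subst (asm) sums_Suc_iff) simp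
    moreover have "z * synthesis \<alpha> z = synthesis \<gamma> z"
      using fun_cong[OF assms(3), of z] by (simp add: mult_z_def)
    ultimately show "(\<lambda>n. (taylor \<gamma> n - case_nat 0 (taylor \<alpha>) n) * z ^ n) sums 0"
      using sums_diff[OF synthesis_sums(2)[OF assms(2) z]] by (fastforce simp: left_diff_distrib)
  qed
  show "\<gamma> 0 = 0" using eq[of 0] a_nonzero by simp
  show "taylor \<gamma> (Suc n) = taylor \<alpha> n" using eq[of "Suc n"] by simp
qed

section \<open>Transport of operators from sequences to functions\<close>

definition lift :: "((nat \<Rightarrow> complex) \<Rightarrow> nat \<Rightarrow> complex) \<Rightarrow> (complex \<Rightarrow> complex) \<Rightarrow> complex \<Rightarrow> complex" where
  "lift T f = synthesis (T (tri_coeff a b f))"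

lemma lift_in_space:
  "bounded_linear_l2 T \<Longrightarrow> f \<in> tri_space a b \<Longrightarrow> lift T f \<in> tri_space a b"
  by (simp add: lift_def bounded_linear_l2D tri_coeff_in_l2)

lemma tri_coeff_lift:
  "bounded_linear_l2 T \<Longrightarrow> f \<in> tri_space a b \<Longrightarrow> tri_coeff a b (lift T f) = T (tri_coeff a b f)"
  by (simp add: lift_def bounded_linear_l2D tri_coeff_in_l2)

lemma bounded_operator_lift:
  assumes T: "bounded_linear_l2 T"
  shows "bounded_operator a b (lift T)"
  unfolding bounded_operator_def
proof (intro conjI ballI allI)
  fix f g assume f: "f \<in> tri_space a b" and g: "g \<in> tri_space a b"
  show "lift T (\<lambda>z. f z + g z) = (\<lambda>z. lift T f z + lift T g z)"
    using T f g by (simp add: lift_def tri_coeff_add bounded_linear_l2D synthesis_add tri_coeff_in_l2)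
next
  fix c f assume f: "f \<in> tri_space a b"
  show "lift T (\<lambda>z. c * f z) = (\<lambda>z. c * lift T f z)"
    using T f by (simp add: lift_def tri_coeff_cmult bounded_linear_l2D synthesis_cmult tri_coeff_in_l2)
next
  obtain C where "\<And>\<alpha>. \<alpha> \<in> l2 \<Longrightarrow> l2norm (T \<alpha>) \<le> C * l2norm \<alpha>"
    using T unfolding bounded_linear_l2_def by blast
  then show "\<exists>C. \<forall>f\<in>tri_space a b. tri_norm a b (lift T f) \<le> C * tri_norm a b f"
    using T by (intro exI[of _ C]) (simp add: tri_norm_eq tri_coeff_lift tri_coeff_in_l2)
qed (rule lift_in_space[OF T])

lemma compact_operator_lift:
  assumes T: "bounded_linear_l2 T"
    and small: "\<And>\<epsilon>. \<epsilon> > 0 \<Longrightarrow>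
      \<exists>N. \<forall>\<alpha>\<in>l2. (\<forall>n<N. \<alpha> n = 0) \<longrightarrow> l2norm (T \<alpha>) \<le> \<epsilon> * l2norm \<alpha>"
  shows "compact_operator a b (lift T)"
  unfolding compact_operator_def
proof (intro conjI allI impI)
  show "bounded_operator a b (lift T)" by (rule bounded_operator_lift[OF T])
  fix F :: "nat \<Rightarrow> complex \<Rightarrow> complex"
  assume "(\<forall>n. F n \<in> tri_space a b) \<and> (\<exists>C. \<forall>n. tri_norm a b (F n) \<le> C)"
  then obtain B where F: "\<And>n. F n \<in> tri_space a b" "\<And>n. tri_norm a b (F n) \<le> B"
    by blast
  obtain r g where r: "strict_mono (r :: nat \<Rightarrow> nat)" and g: "g \<in> l2"
    and lim: "(\<lambda>n. l2norm (\<lambda>j. T (tri_coeff a b (F (r n))) j - g j)) \<longlonglongrightarrow> 0"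
    using compact_criterion_l2[OF T small, of "\<lambda>n. tri_coeff a b (F n)" B] F
    by (auto simp: tri_coeff_in_l2 tri_norm_eq)
  have "tri_norm a b (\<lambda>z. lift T (F (r n)) z - synthesis g z)
      = l2norm (\<lambda>j. T (tri_coeff a b (F (r n))) j - g j)" for n
    using T F g by (simp add: tri_norm_eq tri_coeff_diff lift_in_space tri_coeff_lift)
  with lim have "(\<lambda>n. tri_norm a b (\<lambda>z. lift T (F (r n)) z - synthesis g z)) \<longlonglongrightarrow> 0"
    by simp
  with r g show "\<exists>r. strict_mono r \<and> (\<exists>g\<in>tri_space a b.
      (\<lambda>n. tri_norm a b (\<lambda>z. lift T (F (r n)) z - g z)) \<longlonglongrightarrow> 0)"
    by (intro exI[of _ r]) (auto intro!: bexI[of _ "synthesis g"])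
qed

end

section \<open>Triangular sums of a compact operator and an isometry\<close>

text \<open>Coordinate form of the hypothesis on the sum. Multiplication by z enters only through
  \<open>triangular\<close>: it never lowers the first index of the support.\<close>

locale compact_plus_isometry =
  fixes K S S' :: "(nat \<Rightarrow> complex) \<Rightarrow> nat \<Rightarrow> complex" and C :: real
  assumes K_l2: "\<alpha> \<in> l2 \<Longrightarrow> K \<alpha> \<in> l2"
    and K_bound: "\<alpha> \<in> l2 \<Longrightarrow> l2norm (K \<alpha>) \<le> C * l2norm \<alpha>"
    and K_compact: "\<And>F B. (\<And>n. F n \<in> l2) \<Longrightarrow> (\<And>n. l2norm (F n) \<le> B) \<Longrightarrow>
      \<exists>r. strict_mono (r :: nat \<Rightarrow> nat) \<and>
        (\<exists>g\<in>l2. (\<lambda>n. l2norm (\<lambda>j. K (F (r n)) j - g j)) \<longlonglongrightarrow> 0)"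
    and S_l2: "\<alpha> \<in> l2 \<Longrightarrow> S \<alpha> \<in> l2"
    and S'_l2: "\<alpha> \<in> l2 \<Longrightarrow> S' \<alpha> \<in> l2"
    and adjoint: "\<alpha> \<in> l2 \<Longrightarrow> \<gamma> \<in> l2 \<Longrightarrow> l2inner (S \<alpha>) \<gamma> = l2inner \<alpha> (S' \<gamma>)"
    and S'_S: "\<alpha> \<in> l2 \<Longrightarrow> S' (S \<alpha>) = \<alpha>"
    and triangular: "\<alpha> \<in> l2 \<Longrightarrow> (\<And>j. j < n \<Longrightarrow> \<alpha> j = 0) \<Longrightarrow> j < n \<Longrightarrow> K \<alpha> j + S \<alpha> j = 0"
begin

definition M :: "(nat \<Rightarrow> complex) \<Rightarrow> nat \<Rightarrow> complex" where
  "M \<alpha> j = K \<alpha> j + S \<alpha> j"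

lemma M_l2: "\<alpha> \<in> l2 \<Longrightarrow> M \<alpha> \<in> l2"
  unfolding M_def by (intro l2_add K_l2 S_l2)

lemma S_inner: "\<alpha> \<in> l2 \<Longrightarrow> \<gamma> \<in> l2 \<Longrightarrow> l2inner (S \<alpha>) (S \<gamma>) = l2inner \<alpha> \<gamma>"
  by (simp add: adjoint S_l2 S'_S)

lemma S_norm: "\<alpha> \<in> l2 \<Longrightarrow> l2norm (S \<alpha>) = l2norm \<alpha>"
proof -
  assume \<alpha>: "\<alpha> \<in> l2"
  have "complex_of_real ((l2norm (S \<alpha>))\<^sup>2) = of_real ((l2norm \<alpha>)\<^sup>2)"
    using S_inner[OF \<alpha> \<alpha>] \<alpha> by (simp only: l2inner_self S_l2)
  then have "(l2norm (S \<alpha>))\<^sup>2 = (l2norm \<alpha>)\<^sup>2"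
    by (simp only: of_real_eq_iff)
  then show ?thesis
    using \<alpha> S_l2 by (simp add: power2_eq_iff_nonneg)
qed

lemma M_norm:
  assumes "\<alpha> \<in> l2" "l2norm \<alpha> \<le> B"
  shows "l2norm (M \<alpha>) \<le> \<bar>C + 1\<bar> * B"
proof -
  have "l2norm (M \<alpha>) \<le> (C + 1) * l2norm \<alpha>"
    using l2_add(2)[OF K_l2 S_l2, of \<alpha> \<alpha>] K_bound[of \<alpha>] assms(1)
    unfolding M_def by (simp add: S_norm algebra_simps)
  also have "\<dots> \<le> \<bar>C + 1\<bar> * B"
    using assms by (intro mult_mono) auto
  finally show ?thesis .
qed

text \<open>A cluster point \<open>g\<close> of \<open>K (X n)\<close> is orthogonal to itself, because \<open>K = M - S\<close>,
  \<open>M\<close> is triangular and \<open>S\<close> has an adjoint.\<close>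

lemma K_tail_tendsto_0:
  assumes X: "\<And>n. X n \<in> l2" "\<And>n. l2norm (X n) \<le> B" "\<And>n j. j < n \<Longrightarrow> X n j = 0"
  shows "(\<lambda>n. l2norm (K (X n))) \<longlonglongrightarrow> 0"
proof (rule ccontr)
  assume "\<not> ?thesis"
  then obtain e where e: "e > 0" and "\<not> (\<forall>\<^sub>F n in sequentially. l2norm (K (X n)) < e)"
    by (auto simp: tendsto_iff K_l2 X(1))
  then have inf: "infinite {n. e \<le> l2norm (K (X n))}"
    unfolding infinite_nat_iff_unbounded_le eventually_sequentially by (auto simp: not_less)
  \<comment> \<open>If the norms do not tend to 0, infinitely many stay above \<open>e\<close>.
    Compactness is applied along these indices, and the cluster point will turn out to be 0.\<close>
  define s where "s = enumerate {n. e \<le> l2norm (K (X n))}"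
  have s: "strict_mono s" unfolding s_def by (rule strict_mono_enumerate[OF inf])
  have se: "e \<le> l2norm (K (X (s n)))" for n
    using enumerate_in_set[OF inf, of n] by (simp add: s_def)
  obtain r g where r: "strict_mono (r :: nat \<Rightarrow> nat)" and g: "g \<in> l2"
    and lim: "(\<lambda>n. l2norm (\<lambda>j. K (X (s (r n))) j - g j)) \<longlonglongrightarrow> 0"
    using K_compact[of "\<lambda>n. X (s n)" B] X by blast
  define Y where "Y n = X (s (r n))" for n
  have Y: "Y n \<in> l2" "l2norm (Y n) \<le> B" for n
    using X by (auto simp: Y_def)
  have Y0: "Y n j = 0" if "j < n" for n j
  proof -
    have "n \<le> s (r n)"
      using seq_suble[OF r, of n] seq_suble[OF s, of "r n"] by linarith
    then show ?thesis using X(3) that by (simp add: Y_def)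
  qed
  have "(\<lambda>n. l2inner (M (Y n)) g) \<longlonglongrightarrow> 0"
    by (rule l2inner_tail_tendsto_0[OF _ M_norm[OF Y] _ g])
       (auto simp: M_l2 Y M_def intro!: triangular Y0)
  moreover have "(\<lambda>n. l2inner (Y n) (S' g)) \<longlonglongrightarrow> 0"
    by (rule l2inner_tail_tendsto_0[OF Y Y0]) (auto simp: S'_l2 g)
  moreover have "l2inner (M (Y n)) g = l2inner (K (Y n)) g + l2inner (Y n) (S' g)" for n
    unfolding M_def using Y g by (simp add: l2inner_add_left K_l2 S_l2 adjoint)
  ultimately have KY: "(\<lambda>n. l2inner (K (Y n)) g) \<longlonglongrightarrow> 0"
    using tendsto_diff by fastforce
  have lim': "(\<lambda>n. l2norm (\<lambda>j. K (Y n) j - g j)) \<longlonglongrightarrow> 0"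
    using lim by (simp add: Y_def)
  have "(\<lambda>n. l2inner (\<lambda>j. K (Y n) j - g j) g) \<longlonglongrightarrow> 0"
  proof (rule Lim_null_comparison)
    show "\<forall>\<^sub>F n in sequentially. norm (l2inner (\<lambda>j. K (Y n) j - g j) g)
        \<le> l2norm (\<lambda>j. K (Y n) j - g j) * l2norm g"
      by (intro always_eventually allI l2inner_summable(3) l2_diff K_l2 Y g)
    show "(\<lambda>n. l2norm (\<lambda>j. K (Y n) j - g j) * l2norm g) \<longlonglongrightarrow> 0"
      by (rule tendsto_mult_left_zero[OF lim'])
  qed
  moreover have "l2inner (K (Y n)) g = l2inner (\<lambda>j. K (Y n) j - g j) g + l2inner g g" for n
    using l2inner_add_left[OF l2_diff(1)[OF K_l2[OF Y(1)] g] g g, of n] by simp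
  ultimately have "(\<lambda>n. l2inner (K (Y n)) g) \<longlonglongrightarrow> 0 + l2inner g g"
    by (simp only: tendsto_add tendsto_const)
  from LIMSEQ_unique[OF this KY] have "l2norm g = 0"
    using g by (simp add: l2inner_self)
  \<comment> \<open>Since \<open>g\<close> has norm 0, the lower bound \<open>e\<close> carries over
    from \<open>K (Y n)\<close> to \<open>K (Y n) - g\<close>, whose norm tends to 0.\<close>
  then have "e \<le> l2norm (\<lambda>j. K (Y n) j - g j)" for n
    using l2_add(2)[OF l2_diff(1)[OF K_l2[OF Y(1)] g] g, of n] se[of "r n"] by (simp add: Y_def)
  then have "e \<le> 0"
    by (intro LIMSEQ_le_const[OF lim']) auto
  with e show False by simp
qed

text \<open>Expanding M = K + S leaves <K X, M Y> + <S X, K Y> + <S X, S Y>. The last term is <X,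
  Y>, and the others vanish in the limit because \<open>K\<close> is applied to bounded sequences
  with support moving to infinity.\<close>

lemma M_inner_tendsto:
  assumes X: "\<And>n. X n \<in> l2" "\<And>n. l2norm (X n) \<le> B" "\<And>n j. j < n \<Longrightarrow> X n j = 0"
    and Y: "\<And>n. Y n \<in> l2" "\<And>n. l2norm (Y n) \<le> B'" "\<And>n j. j < n \<Longrightarrow> Y n j = 0"
  shows "(\<lambda>n. l2inner (M (X n)) (M (Y n)) - l2inner (X n) (Y n)) \<longlonglongrightarrow> 0"
proof (rule Lim_null_comparison)
  have "l2inner (M (X n)) (M (Y n)) - l2inner (X n) (Y n)
      = l2inner (K (X n)) (M (Y n)) + l2inner (S (X n)) (K (Y n))" for n
  proof -
    have "l2inner (M (X n)) (M (Y n)) = l2inner (K (X n)) (M (Y n)) + l2inner (S (X n)) (M (Y n))"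
      unfolding M_def[of "X n"] by (intro l2inner_add_left K_l2 S_l2 M_l2 X Y)
    also have "l2inner (S (X n)) (M (Y n)) = l2inner (S (X n)) (K (Y n)) + l2inner (S (X n)) (S (Y n))"
      unfolding M_def by (intro l2inner_add_right K_l2 S_l2 X Y)
    finally show ?thesis by (simp add: S_inner X Y)
  qed
  moreover have "norm (l2inner (K (X n)) (M (Y n)) + l2inner (S (X n)) (K (Y n)))
      \<le> l2norm (K (X n)) * (\<bar>C + 1\<bar> * B') + B * l2norm (K (Y n))" for n
  proof (rule norm_triangle_mono)
    show "norm (l2inner (K (X n)) (M (Y n))) \<le> l2norm (K (X n)) * (\<bar>C + 1\<bar> * B')"
      using l2inner_summable(3)[OF K_l2[OF X(1)] M_l2[OF Y(1)], of n n]
        mult_left_mono[OF M_norm[OF Y(1,2)] l2norm_nonneg[OF K_l2[OF X(1)]], of n n] by linarith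
    show "norm (l2inner (S (X n)) (K (Y n))) \<le> B * l2norm (K (Y n))"
      using l2inner_summable(3)[OF S_l2[OF X(1)] K_l2[OF Y(1)], of n n]
        mult_right_mono[OF X(2) l2norm_nonneg[OF K_l2[OF Y(1)]], of n n]
      by (simp add: S_norm X)
  qed
  ultimately show "\<forall>\<^sub>F n in sequentially. norm (l2inner (M (X n)) (M (Y n)) - l2inner (X n) (Y n))
      \<le> l2norm (K (X n)) * (\<bar>C + 1\<bar> * B') + B * l2norm (K (Y n))"
    by simp
  show "(\<lambda>n. l2norm (K (X n)) * (\<bar>C + 1\<bar> * B') + B * l2norm (K (Y n))) \<longlonglongrightarrow> 0"
    by (intro tendsto_add_zero tendsto_mult_left_zero tendsto_mult_right_zero
        K_tail_tendsto_0[of _ B] K_tail_tendsto_0[of _ B'] X Y)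
qed

end

section \<open>Unit sequences, the coefficients of the basis functions\<close>

definition unit_seq :: "nat \<Rightarrow> nat \<Rightarrow> complex" where
  "unit_seq m n = (if n = m then 1 else 0)"

lemma unit_seq_l2: "unit_seq m \<in> l2" "l2norm (unit_seq m) = 1"
proof -
  have "unit_seq m n = 0" if "n \<ge> Suc m" for n
    using that by (simp add: unit_seq_def)
  note * = l2_finite_support[OF this]
  show "unit_seq m \<in> l2" by (rule *(1))
  have "(\<lambda>i. (cmod (unit_seq m i))\<^sup>2) = (\<lambda>i. if i = m then 1 else 0)"
    by (auto simp: unit_seq_def)
  then show "l2norm (unit_seq m) = 1"
    by (simp only: *(2) L2_set_def) simp
qed

lemma l2inner_unit_seq:
  "l2inner \<alpha> (unit_seq m) = \<alpha> m" "l2inner (unit_seq m) \<alpha> = cnj (\<alpha> m)"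
  unfolding l2inner_def
  by (subst suminf_finite[of "{m}"]; simp add: unit_seq_def)+

lemma partial_norm_single:
  assumes "\<And>n. n \<noteq> m \<Longrightarrow> \<alpha> n = 0" "cmod (\<alpha> m) \<le> B"
  shows "partial_norm \<alpha> k \<le> B"
proof -
  have "\<alpha> = (\<lambda>n. \<alpha> m * unit_seq m n)"
    using assms(1) by (auto simp: unit_seq_def)
  then have "cmod (\<alpha> n) \<le> B * cmod (unit_seq m n)" for n
    using assms by (auto simp: unit_seq_def)
  moreover have "0 \<le> B" using assms(2) norm_ge_zero order_trans by blast
  ultimately have "\<alpha> \<in> l2" "l2norm \<alpha> \<le> B"
    using l2_dominated[OF unit_seq_l2(1), of \<alpha> B m] by (auto simp: unit_seq_l2)
  then show ?thesis using partial_norm_le_l2norm order_trans by blast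
qed

section \<open>The tridiagonal shift\<close>

locale tridiagonal_shift = tridiagonal +
  assumes INF_pos: "(INF n. cmod (a n / a (Suc n))) > 0"
    and bdd: "bdd_above (range (\<lambda>n. cmod (a n / a (Suc n))))"
    and limsup_less: "limsup (\<lambda>n. ereal (cmod (b n / a (Suc n)))) < 1"
begin

definition w :: "nat \<Rightarrow> complex" where "w n = a n / a (Suc n)"
definition \<beta> :: "nat \<Rightarrow> complex" where "\<beta> n = b n / a (Suc n)"
definition d :: "nat \<Rightarrow> complex" where "d n = b n / a n - b (Suc n) / a (Suc n)"
text \<open>This is the coefficient of f_(n+2) in z f_n, equal to
  \<open>(b n - b (Suc n) * w n) / a (Suc (Suc n))\<close>.\<close>

definition \<rho> :: "nat \<Rightarrow> complex" where "\<rho> n = w n * w (Suc n) * d n"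

lemma w_nonzero [simp]: "w n \<noteq> 0"
  by (simp add: w_def a_nonzero)

lemma w_bounds: obtains c C where "c > 0" "\<And>n. c \<le> cmod (w n)" "\<And>n. cmod (w n) \<le> C"
proof (rule that)
  show "(INF n. cmod (w n)) > 0" using INF_pos by (simp add: w_def)
  show "(INF n. cmod (w n)) \<le> cmod (w n)" for n
    by (rule cINF_lower) (auto intro: bdd_belowI[of _ 0])
  show "cmod (w n) \<le> (SUP n. cmod (w n))" for n
    by (rule cSUP_upper) (use bdd in \<open>auto simp: w_def\<close>)
qed

lemma \<beta>_bounds: obtains q N where "q < 1" "\<And>n. n \<ge> N \<Longrightarrow> cmod (\<beta> n) \<le> q"
proof -
  obtain q where q: "limsup (\<lambda>n. ereal (cmod (b n / a (Suc n)))) < ereal q" "ereal q < 1"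
    using ereal_dense2[OF limsup_less] by auto
  from Limsup_lessD[OF q(1)] obtain N where "\<And>n. n \<ge> N \<Longrightarrow> cmod (b n / a (Suc n)) < q"
    by (auto simp: eventually_sequentially)
  then show thesis using that[of q N] q(2) by (force simp: \<beta>_def one_ereal_def)
qed

lemma recur_l2:
  obtains C where "C \<ge> 0" "\<And>y. y \<in> l2 \<Longrightarrow> recur (\<lambda>n. \<beta> (Suc n)) 0 y \<in> l2"
    "\<And>y. y \<in> l2 \<Longrightarrow> l2norm (recur (\<lambda>n. \<beta> (Suc n)) 0 y) \<le> C * l2norm y"
proof -
  obtain q N where q: "q < 1" "\<And>n. n \<ge> N \<Longrightarrow> cmod (\<beta> n) \<le> q"
    by (rule \<beta>_bounds) blast
  have "\<exists>C\<ge>0. \<forall>x y m. partial_norm (recur (\<lambda>n. \<beta> (Suc n)) x y) m \<le> C * (cmod x + partial_norm y m)"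
    by (rule recur_bound[of N _ q]) (use q in auto)
  then obtain C where C: "C \<ge> 0"
    "\<And>x y m. partial_norm (recur (\<lambda>n. \<beta> (Suc n)) x y) m \<le> C * (cmod x + partial_norm y m)"
    by blast
  have *: "partial_norm (recur (\<lambda>n. \<beta> (Suc n)) 0 y) m \<le> C * l2norm y" if "y \<in> l2" for y m
    using C(2)[of 0 y m] mult_left_mono[OF partial_norm_le_l2norm[OF that, of m] C(1)] by simp
  show thesis
    by (rule that[OF C(1)]) (use l2_bounded_partial_norm[OF *] in auto)
qed

text \<open>This determines the coefficients of z f. In the Taylor coefficient of degree m + 2,
  \<open>\<rho> m\<close> is such that \<open>\<alpha> m\<close> receives the factor
  \<open>b m\<close>, and \<open>\<beta> (Suc m)\<close> is such that the recursive terms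
  cancel.\<close>

lemma taylor_shift:
  assumes "\<gamma> 0 = 0"
    and "\<And>n. \<gamma> (Suc n) = w n * \<alpha> n + recur (\<lambda>n. \<beta> (Suc n)) 0 (\<lambda>n. \<rho> n * \<alpha> n) n"
  shows "taylor \<gamma> (Suc n) = taylor \<alpha> n"
proof (cases n)
  case 0
  then show ?thesis using a_nonzero by (simp add: assms w_def)
next
  case (Suc m)
  let ?\<delta> = "recur (\<lambda>n. \<beta> (Suc n)) 0 (\<lambda>n. \<rho> n * \<alpha> n) m"
  have "a (Suc (Suc m)) * \<rho> m + b (Suc m) * w m = b m"
    using a_nonzero by (simp add: \<rho>_def w_def d_def field_simps)
  moreover have "a (Suc (Suc m)) * \<beta> (Suc m) = b (Suc m)" "a (Suc (Suc m)) * w (Suc m) = a (Suc m)"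
    using a_nonzero by (simp_all add: \<beta>_def w_def)
  moreover have "taylor \<gamma> (Suc (Suc m)) = (a (Suc (Suc m)) * w (Suc m)) * \<alpha> (Suc m)
      + (a (Suc (Suc m)) * \<rho> m + b (Suc m) * w m) * \<alpha> m
      + (b (Suc m) - a (Suc (Suc m)) * \<beta> (Suc m)) * ?\<delta>"
    by (simp add: assms algebra_simps)
  ultimately show ?thesis using Suc by simp
qed

section \<open>Sufficiency: an isometric shift plus a compact remainder\<close>

definition shift_part :: "(nat \<Rightarrow> complex) \<Rightarrow> nat \<Rightarrow> complex" where
  "shift_part \<alpha> = case_nat 0 (\<lambda>n. sgn (w n) * \<alpha> n)"

definition shift_adjoint :: "(nat \<Rightarrow> complex) \<Rightarrow> nat \<Rightarrow> complex" where
  "shift_adjoint \<alpha> n = cnj (sgn (w n)) * \<alpha> (Suc n)"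

definition compact_part :: "(nat \<Rightarrow> complex) \<Rightarrow> nat \<Rightarrow> complex" where
  "compact_part \<alpha> = case_nat 0 (\<lambda>n. (w n - sgn (w n)) * \<alpha> n
     + recur (\<lambda>n. \<beta> (Suc n)) 0 (\<lambda>n. \<rho> n * \<alpha> n) n)"

lemma cmod_sgn_w: "cmod (sgn (w n)) = 1"
  by (simp add: norm_sgn)

lemma cnj_sgn_w: "cnj (sgn (w n)) * sgn (w n) = 1"
  using complex_norm_square[of "sgn (w n)"] cmod_sgn_w[of n] by (simp add: mult.commute)

lemma bounded_linear_shift_part: "bounded_linear_l2 shift_part"
proof -
  have *: "shift_part \<alpha> \<in> l2" "l2norm (shift_part \<alpha>) \<le> 1 * l2norm \<alpha>" if "\<alpha> \<in> l2" for \<alpha>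
  proof -
    have "(\<lambda>n. sgn (w n) * \<alpha> n) \<in> l2" "l2norm (\<lambda>n. sgn (w n) * \<alpha> n) \<le> 1 * l2norm \<alpha>"
      using l2_dominated[OF that, of "\<lambda>n. sgn (w n) * \<alpha> n" 1] by (auto simp: norm_mult cmod_sgn_w)
    then show "shift_part \<alpha> \<in> l2" "l2norm (shift_part \<alpha>) \<le> 1 * l2norm \<alpha>"
      by (auto simp: shift_part_def l2_case_nat)
  qed
  show ?thesis
    unfolding bounded_linear_l2_def
    by (intro conjI exI[of _ 1] ballI *)
       (auto simp: shift_part_def fun_eq_iff algebra_simps split: nat.split)
qed

lemma bounded_linear_shift_adjoint: "bounded_linear_l2 shift_adjoint"
proof -
  have *: "shift_adjoint \<alpha> \<in> l2" "l2norm (shift_adjoint \<alpha>) \<le> 1 * l2norm \<alpha>" if "\<alpha> \<in> l2" for \<alpha>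
    using l2_dominated[OF l2_Suc(1)[OF that], of "shift_adjoint \<alpha>" 1] l2_Suc(2)[OF that]
    by (auto simp: shift_adjoint_def norm_mult cmod_sgn_w)
  show ?thesis
    unfolding bounded_linear_l2_def
    by (intro conjI exI[of _ 1] ballI *)
       (auto simp: shift_adjoint_def fun_eq_iff algebra_simps)
qed

lemma shift_adjoint_shift_part: "shift_adjoint (shift_part \<alpha>) = \<alpha>"
  by (simp add: shift_adjoint_def shift_part_def fun_eq_iff cnj_sgn_w flip: mult.assoc)

text \<open>The shifted sequence vanishes at index 0; the remaining terms are reindexed and the
  phase moves to the other argument.\<close>

lemma shift_part_adjoint:
  assumes "\<alpha> \<in> l2" "\<gamma> \<in> l2"
  shows "l2inner (shift_part \<alpha>) \<gamma> = l2inner \<alpha> (shift_adjoint \<gamma>)"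
proof -
  have "summable (\<lambda>n. shift_part \<alpha> n * cnj (\<gamma> n))"
    using assms bounded_linear_l2D(3)[OF bounded_linear_shift_part] by (intro l2inner_summable)
  from suminf_split_head[OF this] show ?thesis
    by (simp add: l2inner_def shift_part_def shift_adjoint_def mult_ac)
qed

lemma isometry_shift_part: "isometry_operator a b (lift shift_part)"
  unfolding isometry_operator_def adjoint_operators_def
proof (intro exI[of _ "lift shift_adjoint"] conjI ballI)
  fix f g assume f: "f \<in> tri_space a b" and g: "g \<in> tri_space a b"
  show "tri_inner a b (lift shift_part f) g = tri_inner a b f (lift shift_adjoint g)"
    using f g by (simp add: tri_inner_eq tri_coeff_lift bounded_linear_shift_part
        bounded_linear_shift_adjoint shift_part_adjoint tri_coeff_in_l2)
next
  fix f assume f: "f \<in> tri_space a b"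
  show "lift shift_adjoint (lift shift_part f) = f"
    unfolding lift_def[of shift_adjoint]
    using f by (simp add: tri_coeff_lift bounded_linear_shift_part
        shift_adjoint_shift_part synthesis_tri_coeff)
qed (auto intro: bounded_operator_lift bounded_linear_shift_part bounded_linear_shift_adjoint)

text \<open>The two hypotheses carry the factor \<open>cmod (\<alpha> n)\<close>, so they restrict
  the weights only where \<open>\<alpha>\<close> is nonzero. One estimate then gives both
  boundedness and smallness on tails.\<close>

lemma compact_part_bound:
  obtains C where "C \<ge> 0"
    "\<And>\<alpha> e. \<lbrakk>\<alpha> \<in> l2; 0 \<le> e; \<And>n. cmod (w n - sgn (w n)) * cmod (\<alpha> n) \<le> e * cmod (\<alpha> n);
      \<And>n. cmod (\<rho> n) * cmod (\<alpha> n) \<le> e * cmod (\<alpha> n)\<rbrakk> \<Longrightarrow>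
      compact_part \<alpha> \<in> l2 \<and> l2norm (compact_part \<alpha>) \<le> C * e * l2norm \<alpha>"
proof -
  obtain C where C: "C \<ge> 0" "\<And>y. y \<in> l2 \<Longrightarrow> recur (\<lambda>n. \<beta> (Suc n)) 0 y \<in> l2"
    "\<And>y. y \<in> l2 \<Longrightarrow> l2norm (recur (\<lambda>n. \<beta> (Suc n)) 0 y) \<le> C * l2norm y"
    by (rule recur_l2) blast
  show thesis
  proof (rule that[of "1 + C"])
    fix \<alpha> :: "nat \<Rightarrow> complex" and e :: real
    assume \<alpha>: "\<alpha> \<in> l2" and e: "0 \<le> e"
      and 1: "\<And>n. cmod (w n - sgn (w n)) * cmod (\<alpha> n) \<le> e * cmod (\<alpha> n)"
      and 2: "\<And>n. cmod (\<rho> n) * cmod (\<alpha> n) \<le> e * cmod (\<alpha> n)"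
    let ?x = "\<lambda>n. (w n - sgn (w n)) * \<alpha> n" and ?y = "\<lambda>n. \<rho> n * \<alpha> n"
    let ?\<delta> = "recur (\<lambda>n. \<beta> (Suc n)) 0 ?y"
    have x: "?x \<in> l2" "l2norm ?x \<le> e * l2norm \<alpha>"
      using l2_dominated[OF \<alpha>, of ?x e] 1 e by (auto simp: norm_mult)
    have y: "?y \<in> l2" "l2norm ?y \<le> e * l2norm \<alpha>"
      using l2_dominated[OF \<alpha>, of ?y e] 2 e by (auto simp: norm_mult)
    have "l2norm ?\<delta> \<le> C * (e * l2norm \<alpha>)"
      using C(3)[OF y(1)] mult_left_mono[OF y(2) C(1)] by linarith
    then have "l2norm (\<lambda>n. ?x n + ?\<delta> n) \<le> (1 + C) * e * l2norm \<alpha>"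
      using l2_add(2)[OF x(1) C(2)[OF y(1)]] x(2) by (simp add: algebra_simps)
    moreover have "(\<lambda>n. ?x n + ?\<delta> n) \<in> l2"
      by (rule l2_add(1)[OF x(1) C(2)[OF y(1)]])
    ultimately show "compact_part \<alpha> \<in> l2 \<and> l2norm (compact_part \<alpha>) \<le> (1 + C) * e * l2norm \<alpha>"
      by (simp add: compact_part_def l2_case_nat)
  qed (use C(1) in auto)
qed

lemma cmod_w_minus_sgn: "cmod (w n - sgn (w n)) = \<bar>cmod (w n) - 1\<bar>"
proof -
  have "w n - sgn (w n) = of_real (cmod (w n) - 1) * sgn (w n)"
    using w_nonzero[of n] by (simp add: sgn_eq field_simps)
  then have "cmod (w n - sgn (w n)) = cmod (of_real (cmod (w n) - 1)) * cmod (sgn (w n))"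
    by (simp only: norm_mult)
  then show ?thesis by (simp only: cmod_sgn_w norm_of_real mult_1_right)
qed

lemma compact_plus_isometry_if:
  assumes w1: "(\<lambda>n. cmod (w n)) \<longlonglongrightarrow> 1" and d0: "d \<longlonglongrightarrow> 0"
  shows "\<exists>K S. compact_operator a b K \<and> isometry_operator a b S \<and>
    (\<forall>f\<in>tri_space a b. mult_z f = (\<lambda>z. K f z + S f z))"
proof (intro exI conjI ballI)
  obtain c C where w: "c > 0" "\<And>n. c \<le> cmod (w n)" "\<And>n. cmod (w n) \<le> C"
    by (rule w_bounds) blast
  have x0: "(\<lambda>n. cmod (w n - sgn (w n))) \<longlonglongrightarrow> 0"
    using tendsto_rabs[OF tendsto_diff[OF w1 tendsto_const[of 1]]] by (simp add: cmod_w_minus_sgn)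
  have \<rho>0: "(\<lambda>n. cmod (\<rho> n)) \<longlonglongrightarrow> 0"
  proof (rule Lim_null_comparison)
    \<comment> \<open>The upper bound on the weights turns the decay of \<open>d\<close> into decay
      of \<open>\<rho>\<close>.\<close>
    show "\<forall>\<^sub>F n in sequentially. norm (cmod (\<rho> n)) \<le> C * C * cmod (d n)"
      using w(3) order_trans[OF norm_ge_zero w(3)]
      by (auto simp: \<rho>_def norm_mult intro!: always_eventually mult_right_mono mult_mono)
    show "(\<lambda>n. C * C * cmod (d n)) \<longlonglongrightarrow> 0"
      by (rule tendsto_mult_right_zero[OF tendsto_norm_zero[OF d0]])
  qed
  obtain Cb where Cb: "Cb \<ge> 0"
    "\<And>\<alpha> e. \<lbrakk>\<alpha> \<in> l2; 0 \<le> e; \<And>n. cmod (w n - sgn (w n)) * cmod (\<alpha> n) \<le> e * cmod (\<alpha> n);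
      \<And>n. cmod (\<rho> n) * cmod (\<alpha> n) \<le> e * cmod (\<alpha> n)\<rbrakk> \<Longrightarrow>
      compact_part \<alpha> \<in> l2 \<and> l2norm (compact_part \<alpha>) \<le> Cb * e * l2norm \<alpha>"
    by (rule compact_part_bound) blast
  obtain e1 where e1: "\<And>n. cmod (w n - sgn (w n)) \<le> e1"
    using convergent_imp_Bseq[OF convergentI[OF x0]] by (auto simp: Bseq_def)
  obtain e2 where e2: "\<And>n. cmod (\<rho> n) \<le> e2"
    using convergent_imp_Bseq[OF convergentI[OF \<rho>0]] by (auto simp: Bseq_def)
  have e: "0 \<le> max e1 e2"
    using order_trans[OF norm_ge_zero e1] by (simp add: le_max_iff_disj)
  \<comment> \<open>Both error sequences converge, hence are bounded; their larger bound serves as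
    \<open>e\<close> for every \<open>\<alpha>\<close>.\<close>
  have bd: "compact_part \<alpha> \<in> l2 \<and> l2norm (compact_part \<alpha>) \<le> Cb * max e1 e2 * l2norm \<alpha>"
    if "\<alpha> \<in> l2" for \<alpha>
    by (rule Cb(2)[OF that e]) (use e1 e2 in \<open>auto intro!: mult_right_mono simp: le_max_iff_disj\<close>)
  have T: "bounded_linear_l2 compact_part"
    unfolding bounded_linear_l2_def
  proof (intro conjI allI)
    show "compact_part (\<lambda>n. \<alpha> n + \<gamma> n) = (\<lambda>n. compact_part \<alpha> n + compact_part \<gamma> n)" for \<alpha> \<gamma>
    proof
      fix n
      show "compact_part (\<lambda>n. \<alpha> n + \<gamma> n) n = compact_part \<alpha> n + compact_part \<gamma> n"
        by (cases n) (simp_all add: compact_part_def distrib_left recur_add)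
    qed
    show "compact_part (\<lambda>n. c * \<alpha> n) = (\<lambda>n. c * compact_part \<alpha> n)" for c \<alpha>
    proof
      fix n
      show "compact_part (\<lambda>n. c * \<alpha> n) n = c * compact_part \<alpha> n"
        by (cases n) (simp_all add: compact_part_def distrib_left mult.left_commute[of _ c] recur_cmult)
    qed
    show "\<exists>C\<ge>0. \<forall>\<alpha>\<in>l2. compact_part \<alpha> \<in> l2 \<and> l2norm (compact_part \<alpha>) \<le> C * l2norm \<alpha>"
      using bd Cb(1) e by (intro exI[of _ "Cb * max e1 e2"]) auto
  qed
  show "compact_operator a b (lift compact_part)"
  proof (rule compact_operator_lift[OF T])
    fix \<epsilon> :: real assume \<epsilon>: "\<epsilon> > 0"
    define \<eta> where "\<eta> = \<epsilon> / (Cb + 1)"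
    have \<eta>: "\<eta> > 0" "Cb * \<eta> \<le> \<epsilon>"
      using \<epsilon> Cb(1) by (auto simp: \<eta>_def field_simps)
    have "\<forall>\<^sub>F n in sequentially. cmod (w n - sgn (w n)) < \<eta> \<and> cmod (\<rho> n) < \<eta>"
      using order_tendstoD(2)[OF x0 \<eta>(1)] order_tendstoD(2)[OF \<rho>0 \<eta>(1)] by eventually_elim auto
    then obtain N where N: "\<And>n. n \<ge> N \<Longrightarrow> cmod (w n - sgn (w n)) < \<eta> \<and> cmod (\<rho> n) < \<eta>"
      by (auto simp: eventually_sequentially)
    have "l2norm (compact_part \<alpha>) \<le> \<epsilon> * l2norm \<alpha>" if \<alpha>: "\<alpha> \<in> l2" "\<forall>n<N. \<alpha> n = 0" for \<alpha>
    proof -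
      have "cmod (w n - sgn (w n)) * cmod (\<alpha> n) \<le> \<eta> * cmod (\<alpha> n)"
        "cmod (\<rho> n) * cmod (\<alpha> n) \<le> \<eta> * cmod (\<alpha> n)" for n
        \<comment> \<open>Below \<open>N\<close> both sides vanish with \<open>\<alpha> n\<close>;
          from \<open>N\<close> on the weights are smaller than \<open>\<eta>\<close>.\<close>
        using N[of n] \<alpha>(2) by (cases "n < N"; auto intro!: mult_right_mono)+
      then have "l2norm (compact_part \<alpha>) \<le> Cb * \<eta> * l2norm \<alpha>"
        using Cb(2)[OF \<alpha>(1), of \<eta>] \<eta>(1) by simp
      also have "\<dots> \<le> \<epsilon> * l2norm \<alpha>"
        by (intro mult_right_mono \<eta> l2norm_nonneg \<alpha>)
      finally show ?thesis .
    qed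
    then show "\<exists>N. \<forall>\<alpha>\<in>l2. (\<forall>n<N. \<alpha> n = 0) \<longrightarrow> l2norm (compact_part \<alpha>) \<le> \<epsilon> * l2norm \<alpha>"
      by blast
  qed
  show "isometry_operator a b (lift shift_part)" by (rule isometry_shift_part)
  fix f assume "f \<in> tri_space a b"
  then obtain \<alpha> where \<alpha>: "\<alpha> \<in> l2" "f = synthesis \<alpha>" by (auto simp: tri_space_eq)
  have l2: "compact_part \<alpha> \<in> l2" "shift_part \<alpha> \<in> l2"
    using \<alpha>(1) T bounded_linear_shift_part by (simp_all add: bounded_linear_l2D)
  have "mult_z f = synthesis (\<lambda>n. compact_part \<alpha> n + shift_part \<alpha> n)"
    unfolding \<alpha>(2)
  proof (rule mult_z_synthesis[OF \<alpha>(1)])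
    show "(\<lambda>n. compact_part \<alpha> n + shift_part \<alpha> n) \<in> l2" by (rule l2_add(1)[OF l2])
    show "compact_part \<alpha> 0 + shift_part \<alpha> 0 = 0"
      by (simp add: compact_part_def shift_part_def)
    show "taylor (\<lambda>n. compact_part \<alpha> n + shift_part \<alpha> n) (Suc n) = taylor \<alpha> n" for n
      by (rule taylor_shift)
         (simp_all add: compact_part_def shift_part_def algebra_simps)
  qed
  also have "\<dots> = (\<lambda>z. lift compact_part f z + lift shift_part f z)"
    using l2 \<alpha> by (simp add: synthesis_add lift_def)
  finally show "mult_z f = (\<lambda>z. lift compact_part f z + lift shift_part f z)" .
qed

section \<open>Necessity: testing against the quotients f_(n+2) / z\<close>

text \<open>The coefficients of \<open>f\<^bsub>n+2\<^esub>(z) / z\<close>.\<close>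

definition quotient_seq :: "nat \<Rightarrow> nat \<Rightarrow> complex" where
  "quotient_seq n = recur \<beta> 0 (\<lambda>j. taylor (unit_seq (n + 2)) (j + 2) / a (Suc j))"

lemma quotient_seq_0: "j \<le> n \<Longrightarrow> quotient_seq n j = 0"
proof (induction j)
  case 0
  show ?case by (simp add: quotient_seq_def)
next
  case (Suc j)
  \<comment> \<open>The Taylor series of f_(n+2) starts at degree n + 2, and here
    \<open>j + 2\<close> is smaller; so the quotient starts only at index n + 1.\<close>
  then have "taylor (unit_seq (n + 2)) (j + 2) = 0"
    by (simp add: unit_seq_def)
  moreover have "quotient_seq n j = 0" using Suc by simp
  ultimately show ?case by (simp add: quotient_seq_def)
qed

lemma quotient_seq_first: "quotient_seq n (Suc n) = 1 / w (Suc n)"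
  using quotient_seq_0[of n n] by (simp add: quotient_seq_def unit_seq_def w_def)

text \<open>The input of the recurrence has at most two nonzero entries,
  \<open>1 / w (Suc n)\<close> and \<open>b (n + 2) / a (n + 2)\<close>. Both are bounded uniformly
  in \<open>n\<close>, since the weights are bounded away from 0 and \<open>\<beta>\<close> is
  bounded.\<close>

lemma quotient_seq_bounded:
  obtains B where "\<And>n. quotient_seq n \<in> l2" "\<And>n. l2norm (quotient_seq n) \<le> B"
proof -
  obtain c C where w: "c > 0" "\<And>n. c \<le> cmod (w n)" "\<And>n. cmod (w n) \<le> C"
    by (rule w_bounds) blast
  obtain q N where q: "q < 1" "\<And>n. n \<ge> N \<Longrightarrow> cmod (\<beta> n) \<le> q"
    by (rule \<beta>_bounds) blast
  have "\<exists>C\<ge>0. \<forall>x y m. partial_norm (recur \<beta> x y) m \<le> C * (cmod x + partial_norm y m)"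
    by (rule recur_bound[of N _ q]) (use q in auto)
  then obtain D where D: "D \<ge> 0"
    "\<And>x y m. partial_norm (recur \<beta> x y) m \<le> D * (cmod x + partial_norm y m)"
    by blast
  have "\<forall>\<^sub>F n in sequentially. norm (\<beta> n) \<le> 1"
    unfolding eventually_sequentially using q by (intro exI[of _ N]) force
  then have "Bseq \<beta>"
    by (rule Bseq_eventually_mono[of \<beta> "\<lambda>_. 1 :: real", simplified])
  then obtain E where E: "\<And>n. cmod (\<beta> n) \<le> E" by (auto simp: Bseq_def)
  have winv: "cmod (1 / w n) \<le> 1 / c" for n
    using w(1) w(2)[of n] by (simp add: norm_divide frac_le)
  have "partial_norm (quotient_seq n) m \<le> D * (1 / c + E / c)" for n m
  proof -
    define y where "y j = (if j = n then 1 / w (Suc n) else 0)" for j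
    define y' where "y' j = (if j = Suc n then b (n + 2) / a (n + 2) else 0)" for j
    have y: "partial_norm y m \<le> 1 / c"
      by (rule partial_norm_single[of n]) (use winv in \<open>auto simp: y_def\<close>)
    \<comment> \<open>Inserting \<open>a (n + 3)\<close> writes the quotient as
      \<open>\<beta>\<close> divided by \<open>w\<close>, both of which are under control.\<close>
    have "cmod (b (n + 2) / a (n + 2)) = cmod (\<beta> (n + 2)) * cmod (1 / w (n + 2))"
      by (simp add: \<beta>_def w_def a_nonzero norm_mult norm_divide)
    also have "\<dots> \<le> E * (1 / c)"
      using E order_trans[OF norm_ge_zero E] winv by (intro mult_mono) auto
    finally have y': "partial_norm y' m \<le> E / c"
      by (intro partial_norm_single[of "Suc n"]) (auto simp: y'_def)
    have "taylor (unit_seq (n + 2)) (j + 2) / a (Suc j) = y j + y' j" for j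
      by (auto simp: unit_seq_def y_def y'_def w_def)
    then have "quotient_seq n = recur \<beta> 0 (\<lambda>j. y j + y' j)"
      by (simp add: quotient_seq_def)
    then have "partial_norm (quotient_seq n) m \<le> D * partial_norm (\<lambda>j. y j + y' j) m"
      using D(2)[of 0 "\<lambda>j. y j + y' j" m] by simp
    also have "\<dots> \<le> D * (1 / c + E / c)"
      using partial_norm_add[of y y' m] y y' D(1) by (intro mult_left_mono) auto
    finally show ?thesis .
  qed
  from l2_bounded_partial_norm[OF this] show thesis by (intro that)
qed

lemma mult_z_quotient_seq:
  assumes "quotient_seq n \<in> l2"
  shows "mult_z (synthesis (quotient_seq n)) = synthesis (unit_seq (n + 2))"
proof (rule mult_z_synthesis[OF assms unit_seq_l2(1)])
  show "unit_seq (n + 2) 0 = 0" by (simp add: unit_seq_def)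
  fix j
  show "taylor (unit_seq (n + 2)) (Suc j) = taylor (quotient_seq n) j"
  proof (cases j)
    \<comment> \<open>The initial value 0 is right because f_(n+2) has no term of degree 1.\<close>
    case 0
    then show ?thesis by (simp add: quotient_seq_def unit_seq_def)
  next
    case (Suc i)
    have "quotient_seq n (Suc i) = taylor (unit_seq (n + 2)) (Suc j) / a (Suc i) - \<beta> i * quotient_seq n i"
      by (simp add: quotient_seq_def Suc)
    moreover have "a (Suc i) * (\<beta> i * quotient_seq n i) = b i * quotient_seq n i"
      by (simp add: \<beta>_def a_nonzero)
    ultimately have "a (Suc i) * quotient_seq n (Suc i) + b i * quotient_seq n i
        = taylor (unit_seq (n + 2)) (Suc j)"
      by (auto simp: right_diff_distrib a_nonzero simp del: taylor_simps)
    then show ?thesis by (simp only: Suc taylor_simps(2)[of "quotient_seq n" i])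
  qed
qed

lemma compact_plus_isometry_only_if:
  assumes K: "compact_operator a b K" and S: "isometry_operator a b S"
    and M: "\<And>f. f \<in> tri_space a b \<Longrightarrow> mult_z f = (\<lambda>z. K f z + S f z)"
  shows "(\<lambda>n. cmod (w n)) \<longlonglongrightarrow> 1" "d \<longlonglongrightarrow> 0"
proof -
  obtain S' where S': "adjoint_operators a b S S'" "\<And>f. f \<in> tri_space a b \<Longrightarrow> S' (S f) = f"
    using S by (auto simp: isometry_operator_def)
  have Kb: "bounded_operator a b K" using K by (simp add: compact_operator_def)
  have Sp: "K f \<in> tri_space a b" "S f \<in> tri_space a b" "S' f \<in> tri_space a b"
    if "f \<in> tri_space a b" for f
    using Kb S'(1) that by (simp_all add: adjoint_operators_def bounded_operator_def)
  obtain C where C: "\<And>f. f \<in> tri_space a b \<Longrightarrow> tri_norm a b (K f) \<le> C * tri_norm a b f"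
    using Kb unfolding bounded_operator_def by blast
  define k where "k \<alpha> = tri_coeff a b (K (synthesis \<alpha>))" for \<alpha>
  define s where "s \<alpha> = tri_coeff a b (S (synthesis \<alpha>))" for \<alpha>
  define s' where "s' \<alpha> = tri_coeff a b (S' (synthesis \<alpha>))" for \<alpha>
  have l2: "k \<alpha> \<in> l2" "s \<alpha> \<in> l2" "s' \<alpha> \<in> l2" if "\<alpha> \<in> l2" for \<alpha>
    using that by (simp_all add: k_def s_def s'_def tri_coeff_in_l2 Sp)
  have syn: "mult_z (synthesis \<alpha>) = synthesis (\<lambda>j. k \<alpha> j + s \<alpha> j)" if "\<alpha> \<in> l2" for \<alpha>
    using that l2[OF that] by (simp add: M synthesis_add) (simp add: k_def s_def synthesis_tri_coeff Sp)
  note tay = taylor_mult_z[OF _ l2_add(1)[OF l2(1,2)] syn]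
  \<comment> \<open>The conclusion reaches \<open>j = n\<close>: multiplication by z raises the
    first index of the support by at least one. The entry at \<open>n\<close> is used again for the
    images of the unit sequences.\<close>
  have tri: "k \<alpha> j + s \<alpha> j = 0" if \<alpha>: "\<alpha> \<in> l2" "\<And>j. j < n \<Longrightarrow> \<alpha> j = 0" "j \<le> n" for \<alpha> n j
    using \<alpha>(3)
  proof (induction j)
    case 0
    show ?case using tay(1) \<alpha>(1) by simp
  next
    case (Suc j)
    have "taylor \<alpha> j = 0" using \<alpha>(2) Suc.prems by (cases j) simp_all
    then have "a (Suc j) * (k \<alpha> (Suc j) + s \<alpha> (Suc j)) + b j * (k \<alpha> j + s \<alpha> j) = 0"
      using tay(2)[OF \<alpha>(1) \<alpha>(1) \<alpha>(1) \<alpha>(1), of j] by simp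
    then show ?case using Suc a_nonzero by simp
  qed
  interpret cpi: compact_plus_isometry k s s' C
  proof
    fix \<alpha> \<gamma> :: "nat \<Rightarrow> complex" assume \<alpha>: "\<alpha> \<in> l2"
    show "l2norm (k \<alpha>) \<le> C * l2norm \<alpha>"
      using C[of "synthesis \<alpha>"] \<alpha> by (simp add: tri_norm_eq k_def)
    show "s' (s \<alpha>) = \<alpha>"
      using \<alpha> by (simp add: s_def s'_def synthesis_tri_coeff Sp S'(2))
    show "l2inner (s \<alpha>) \<gamma> = l2inner \<alpha> (s' \<gamma>)" if "\<gamma> \<in> l2"
    proof -
      have "tri_inner a b (S (synthesis \<alpha>)) (synthesis \<gamma>) = tri_inner a b (synthesis \<alpha>) (S' (synthesis \<gamma>))"
        using S'(1) \<alpha> that by (simp add: adjoint_operators_def)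
      then show ?thesis using \<alpha> that by (simp add: tri_inner_eq s_def s'_def)
    qed
    show "k \<alpha> j + s \<alpha> j = 0" if "\<And>j. j < n \<Longrightarrow> \<alpha> j = 0" "j < n" for n j
      using tri[OF \<alpha> that(1)] that(2) by simp
  next
    fix F :: "nat \<Rightarrow> nat \<Rightarrow> complex" and B
    assume F: "\<And>n. F n \<in> l2" "\<And>n. l2norm (F n) \<le> B"
    have "\<exists>r. strict_mono (r :: nat \<Rightarrow> nat) \<and> (\<exists>g\<in>tri_space a b.
        (\<lambda>n. tri_norm a b (\<lambda>z. K (synthesis (F (r n))) z - g z)) \<longlonglongrightarrow> 0)"
      using K[unfolded compact_operator_def, THEN conjunct2, rule_format, of "\<lambda>n. synthesis (F n)"] F
      by (auto simp: tri_norm_eq)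
    then obtain r g where r: "strict_mono (r :: nat \<Rightarrow> nat)" and g: "g \<in> tri_space a b"
      and lim: "(\<lambda>n. tri_norm a b (\<lambda>z. K (synthesis (F (r n))) z - g z)) \<longlonglongrightarrow> 0"
      by blast
    have "tri_norm a b (\<lambda>z. K (synthesis (F (r n))) z - g z)
        = l2norm (\<lambda>j. k (F (r n)) j - tri_coeff a b g j)" for n
      using F g by (simp add: tri_norm_eq tri_coeff_diff Sp k_def)
    with lim r g show "\<exists>r. strict_mono (r :: nat \<Rightarrow> nat) \<and>
        (\<exists>g\<in>l2. (\<lambda>n. l2norm (\<lambda>j. k (F (r n)) j - g j)) \<longlonglongrightarrow> 0)"
      by (intro exI[of _ r] conjI bexI[of _ "tri_coeff a b g"]) (simp_all add: tri_coeff_in_l2)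
  qed (auto intro: l2)
  obtain B where Q: "\<And>n. quotient_seq n \<in> l2" "\<And>n. l2norm (quotient_seq n) \<le> B"
    by (rule quotient_seq_bounded) blast
  have MQ: "cpi.M (quotient_seq n) = unit_seq (n + 2)" for n
  proof (rule synthesis_inject)
    show "cpi.M (quotient_seq n) \<in> l2" by (rule cpi.M_l2[OF Q(1)])
    show "synthesis (cpi.M (quotient_seq n)) = synthesis (unit_seq (n + 2))"
      using syn[OF Q(1)] mult_z_quotient_seq[OF Q(1)]
      by (simp add: cpi.M_def[abs_def])
  qed (rule unit_seq_l2)
  \<comment> \<open>The entries at n + 1 and n + 2 are read off from the Taylor coefficients of z
    f_n at these degrees, given that the entry at n is 0.\<close>
  have M1: "cpi.M (unit_seq n) (Suc n) = w n" and M2: "cpi.M (unit_seq n) (Suc (Suc n)) = \<rho> n" for n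
  proof -
    let ?m = "cpi.M (unit_seq n)"
    note U = unit_seq_l2(1)[of n]
    have t: "taylor ?m (Suc j) = taylor (unit_seq n) j" for j
      using tay(2)[OF U U U U, of j] by (simp add: cpi.M_def[abs_def] del: taylor_simps)
    have "?m n = 0"
      unfolding cpi.M_def by (rule tri[OF U, of n]) (simp_all add: unit_seq_def)
    moreover have "taylor (unit_seq n) n = a n" by (cases n) (simp_all add: unit_seq_def)
    ultimately show 1: "?m (Suc n) = w n"
      using t[of n] a_nonzero[of "Suc n"] by (simp add: w_def field_simps)
    have "a (Suc (Suc n)) * ?m (Suc (Suc n)) + b (Suc n) * w n = b n"
      using t[of "Suc n"] 1 by (simp add: unit_seq_def)
    then have "?m (Suc (Suc n)) = (b n - b (Suc n) * w n) / a (Suc (Suc n))"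
      using a_nonzero by (simp add: field_simps)
    also have "\<dots> = \<rho> n"
      using a_nonzero by (simp add: \<rho>_def w_def d_def field_simps)
    finally show "?m (Suc (Suc n)) = \<rho> n" .
  qed
  \<comment> \<open>Pairing with f_(n+2) picks out the entry \<open>\<rho> n\<close> of z f_n, while
    <f_n, f_(n+2) / z> is 0 because the quotient starts at n + 1.\<close>
  have "(\<lambda>n. l2inner (cpi.M (unit_seq n)) (cpi.M (quotient_seq n)) - l2inner (unit_seq n) (quotient_seq n)) \<longlonglongrightarrow> 0"
    by (rule cpi.M_inner_tendsto[where B=1, OF unit_seq_l2(1) _ _ Q])
       (auto simp: unit_seq_l2 quotient_seq_0 unit_seq_def)
  then have \<rho>0: "\<rho> \<longlonglongrightarrow> 0"
    by (simp add: MQ l2inner_unit_seq M2 quotient_seq_0)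
  \<comment> \<open>One index higher, the entry is the weight \<open>w (Suc n)\<close>, and the
    second pairing is the conjugate of the leading coefficient of the quotient.\<close>
  have "(\<lambda>n. l2inner (cpi.M (unit_seq (Suc n))) (cpi.M (quotient_seq n)) - l2inner (unit_seq (Suc n)) (quotient_seq n)) \<longlonglongrightarrow> 0"
    by (rule cpi.M_inner_tendsto[where B=1, OF unit_seq_l2(1) _ _ Q])
       (auto simp: unit_seq_l2 quotient_seq_0 unit_seq_def)
  then have w0: "(\<lambda>n. w (Suc n) - cnj (1 / w (Suc n))) \<longlonglongrightarrow> 0"
    by (simp add: MQ l2inner_unit_seq M1 quotient_seq_first)
  obtain c C where w: "c > 0" "\<And>n. c \<le> cmod (w n)" "\<And>n. cmod (w n) \<le> C"
    by (rule w_bounds) blast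
  show "d \<longlonglongrightarrow> 0"
  proof (rule Lim_null_comparison)
    \<comment> \<open>The positive lower bound on the weights recovers the decay of \<open>d\<close>
      from that of \<open>\<rho>\<close>.\<close>
    have "c * c * cmod (d n) \<le> cmod (\<rho> n)" for n
      unfolding \<rho>_def norm_mult using w(1,2) by (intro mult_right_mono mult_mono) (auto intro: less_imp_le)
    then show "\<forall>\<^sub>F n in sequentially. norm (d n) \<le> cmod (\<rho> n) / (c * c)"
      using w(1) by (simp add: field_simps)
    show "(\<lambda>n. cmod (\<rho> n) / (c * c)) \<longlonglongrightarrow> 0"
      using tendsto_divide[OF tendsto_norm_zero[OF \<rho>0] tendsto_const[of "c * c"]] w(1) by simp
  qed
  have "(\<lambda>n. (cmod (w (Suc n)))\<^sup>2 - 1) \<longlonglongrightarrow> 0"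
  proof (rule Lim_null_comparison)
    have "\<bar>(cmod (w n))\<^sup>2 - 1\<bar> \<le> cmod (w n - cnj (1 / w n)) * C" for n
    proof -
      \<comment> \<open>Multiplying w - 1 / cnj w by cnj w gives |w|^2 - 1, and this factor is
        bounded by \<open>C\<close>.\<close>
      have "complex_of_real ((cmod (w n))\<^sup>2 - 1) = (w n - cnj (1 / w n)) * cnj (w n)"
        by (simp add: complex_norm_square left_diff_distrib del: of_real_power)
      then have "\<bar>(cmod (w n))\<^sup>2 - 1\<bar> = cmod ((w n - cnj (1 / w n)) * cnj (w n))"
        by (metis norm_of_real)
      also have "\<dots> = cmod (w n - cnj (1 / w n)) * cmod (w n)"
        by (simp only: norm_mult complex_mod_cnj)
      also have "\<dots> \<le> cmod (w n - cnj (1 / w n)) * C"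
        using w(3) by (intro mult_left_mono) auto
      finally show ?thesis .
    qed
    then show "\<forall>\<^sub>F n in sequentially. norm ((cmod (w (Suc n)))\<^sup>2 - 1)
        \<le> cmod (w (Suc n) - cnj (1 / w (Suc n))) * C" by simp
    show "(\<lambda>n. cmod (w (Suc n) - cnj (1 / w (Suc n))) * C) \<longlonglongrightarrow> 0"
      by (rule tendsto_mult_left_zero[OF tendsto_norm_zero[OF w0]])
  qed
  from tendsto_add[OF this tendsto_const[of 1]]
  have "(\<lambda>n. (cmod (w (Suc n)))\<^sup>2) \<longlonglongrightarrow> 1" by simp
  from tendsto_real_sqrt[OF this] have "(\<lambda>n. cmod (w (Suc n))) \<longlonglongrightarrow> 1" by simp
  then show "(\<lambda>n. cmod (w n)) \<longlonglongrightarrow> 1" by (rule LIMSEQ_imp_Suc)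
qed

end

theorem theorem1p2:
  fixes a b :: "nat \<Rightarrow> complex"
  assumes "\<And>n. a n \<noteq> 0"
    and "(INF n. cmod (a n / a (Suc n))) > 0"
    and "bdd_above (range (\<lambda>n. cmod (a n / a (Suc n))))"
    and "limsup (\<lambda>n. ereal (cmod (b n / a (Suc n)))) < 1"
    and "\<And>z w. z \<in> ball 0 1 \<Longrightarrow> w \<in> ball 0 1 \<Longrightarrow>
           summable (\<lambda>n. tri_fun a b n z * cnj (tri_fun a b n w))"
  shows "(\<exists>K S. compact_operator a b K \<and> isometry_operator a b S \<and>
            (\<forall>f\<in>tri_space a b. mult_z f = (\<lambda>z. K f z + S f z))) \<longleftrightarrow>
         ((\<lambda>n. cmod (a n / a (Suc n))) \<longlonglongrightarrow> 1 \<and>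
          (\<lambda>n. cmod (b n / a n - b (Suc n) / a (Suc n))) \<longlonglongrightarrow> 0)"
proof -
  interpret tridiagonal_shift a b
    by unfold_locales (fact assms)+
  have eq: "((\<lambda>n. cmod (a n / a (Suc n))) \<longlonglongrightarrow> 1 \<and>
      (\<lambda>n. cmod (b n / a n - b (Suc n) / a (Suc n))) \<longlonglongrightarrow> 0) \<longleftrightarrow>
      (\<lambda>n. cmod (w n)) \<longlonglongrightarrow> 1 \<and> d \<longlonglongrightarrow> 0"
    unfolding w_def d_def[abs_def] tendsto_norm_zero_iff ..
  show ?thesis
    unfolding eq using compact_plus_isometry_if compact_plus_isometry_only_if by blast
qed

end
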